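(* Let $p_1<p_2$ be primes, $q=p_1p_2$, let $m_1,m_2>0$ be integers, $m=m_1+m_2$, and $L=p_1^{m_1}p_2^{m_2}$. Let $f_i,f_i':\mathbb{Z}_q\to\mathbb{Z}_q$ ($i=1,\dots,m_1-1$) and $h_j,h_j':\mathbb{Z}_q\to\mathbb{Z}_q$ ($j=1,\dots,m_2-1$) be functions. For any choice of functions $f_0,h_0,g_\alpha,g'_\beta:\mathbb{Z}_q\to\mathbb{Z}_q$ ($\alpha=1,\dots,m_1$, $\beta=1,\dots,m_2$), one-to-one mappings $\pi:\{1,\dots,m_1\}\to\{1,\dots,m_1\}$ and $\pi':\{m_1+1,\dots,m\}\to\{m_1+1,\dots,m\}$, and $\lambda\in\mathbb{Z}_q$, let $f:\mathbf{Z}_{p_1}^{m_1}\times\mathbf{Z}_{p_2}^{m_2}\to\mathbb{Z}_q$ be given by $$f(x_1,\dots,x_m)=\frac{q}{p_1}\sum_{i=1}^{m_1-1}f_i(x_{\pi(i)})f_i'(x_{\pi(i+1)})+\sum_{\alpha=1}^{m_1}g_\alpha(x_\alpha)+\frac{q}{p_2}\sum_{j=1}^{m_2-1}h_j(x_{\pi'(m_1+j)})h_j'(x_{\pi'(m_1+j+1)})+\sum_{\beta=1}^{m_2}g'_\beta(x_{\beta+m_1})+\lambda f_0(x_{\pi(m_1)})h_0(x_{\pi'(m_1+1)}),$$ and for $t=p_1t_2+t_1$ with $t_i\in\mathbf{Z}_{p_i}$ let $$\psi(C_t)=\Big\{\psi\Big(f+\frac{q}{p_1}\big(d_1x_{\pi(1)}+t_1x_{\pi(m_1)}\big)+\frac{q}{p_2}\big(d_2x_{\pi'(m_1+1)}+t_2x_{\pi'(m)}\big)\Big):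 d_i\in\mathbf{Z}_{p_i},\ i=1,2\Big\}.$$ Then the set of codes $\mathcal{C}=\{\psi(C_t): t=0,1,\dots,p_1p_2-1\}$ forms $(p_1p_2,L)$-CCCs if and only if $f_i$ and $f_i'$ permute the set $\mathbf{Z}_{p_1}$ under modulo $p_1$ for all $i=1,\dots,m_1-1$, and $h_j$ and $h_j'$ permute the set $\mathbf{Z}_{p_2}$ under modulo $p_2$ for all $j=1,\dots,m_2-1$.
   Context: $\mathbb{Z}_q$ is the ring of integers modulo $q$, with elements represented by $0,1,\dots,q-1$; for $p\mid q$, $\mathbf{Z}_p=\{0,1,\dots,p-1\}\subset\mathbb{Z}_q$ (as a subset); arithmetic in values of $q$-ary functions is modulo $q$. $\xi_q=\exp(2\pi\sqrt{-1}/q)$. A function $\phi:\mathbb{Z}_q\to\mathbb{Z}_q$ permutes $\mathbf{Z}_p$ under modulo $p$ if the map $u\mapsto \phi(u)\bmod p$ is a bijection from $\mathbf{Z}_p$ to $\mathbf{Z}_p$. Sequence of a function: for $F:\mathbf{Z}_{p_1}^{m_1}\times\mathbf{Z}_{p_2}^{m_2}\to\mathbb{Z}_q$, $\psi(F)=(\xi_q^{F_0},\dots,\xi_q^{F_{L-1}})$, where $F_x=F(x_1,\dots,x_m)$ and $(x_1,\dots,x_m)\in\mathbf{Z}_{p_1}^{m_1}\times\mathbf{Z}_{p_2}^{m_2}$ is determined by $x=\sum_{j=1}^{m_1}x_jp_1^{j-1}+p_1^{m_1}\sum_{j=1}^{m_2}x_{m_1+j}p_2^{j-1}$. Aperiodic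 correlation: for complex sequences $\mathbf{a},\mathbf{b}$ of length $L$ and an integer $\tau$ with $|\tau|<L$, $\Theta(\mathbf{a},\mathbf{b})(\tau)=\sum_{s=0}^{L-\tau-1}a_s b_{s+\tau}^*$ if $0\le\tau<L$, and $\Theta(\mathbf{a},\mathbf{b})(\tau)=\sum_{s=0}^{L+\tau-1}a_{s-\tau}b_s^*$ if $-L<\tau<0$. A code is an ordered tuple of $M$ complex sequences of length $L$; for codes $\mathbf{C}=(\mathbf{c}^1,\dots,\mathbf{c}^M)$, $\mathbf{D}=(\mathbf{d}^1,\dots,\mathbf{d}^M)$ put $\Theta(\mathbf{C},\mathbf{D})(\tau)=\sum_{\ell=1}^M\Theta(\mathbf{c}^\ell,\mathbf{d}^\ell)(\tau)$. Here each code $\psi(C_t)$ is regarded as a tuple of sequences indexed by $(d_1,d_2)$, in the same order for all $t$. $(M,L)$-CCCs (complete complementary codes): a family of $M$ codes $\mathbf{C}_1,\dots,\mathbf{C}_M$, each consisting of $M$ sequences of length $L$, such that $\Theta(\mathbf{C}_{k_1},\mathbf{C}_{k_2})(\tau)=ML$ if $\tau=0$ and $k_1=k_2$; $=0$ if $0<|\tau|<L$ and $k_1=k_2$; and $=0$ if $|\tau|<L$ and $k_1\ne k_2$. *)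

theory Defs
  imports Complex_Main "HOL-Library.FuncSet" "HOL-Computational_Algebra.Primes"
begin

text \<open>
  The ring of integers modulo \<open>q\<close> is represented by the residues \<open>{0..<q}\<close> of type \<^typ>\<open>nat\<close>;
  a function from this ring to itself is a function in \<open>{0..<q} \<rightarrow> {0..<q}\<close>.
\<close>

definition permutes_mod :: "nat \<Rightarrow> (nat \<Rightarrow> nat) \<Rightarrow> bool" where
  "permutes_mod p \<phi> \<longleftrightarrow> bij_betw (\<lambda>u. \<phi> u mod p) {0..<p} {0..<p}"

definition xi :: "nat \<Rightarrow> complex" where
  "xi q = exp (2 * of_real pi * \<i> / of_nat q)"

text \<open>Tuples \<open>(x\<^sub>1, \<dots>, x\<^bsub>m1+m2\<^esub>)\<close> are extensional functions on \<open>{1..m1+m2}\<close>.\<close>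

definition mixed_tuples :: "nat \<Rightarrow> nat \<Rightarrow> nat \<Rightarrow> nat \<Rightarrow> (nat \<Rightarrow> nat) set" where
  "mixed_tuples p1 m1 p2 m2 =
     (\<Pi>\<^sub>E j\<in>{1..m1+m2}. if j \<le> m1 then {0..<p1} else {0..<p2})"

definition tuple_index :: "nat \<Rightarrow> nat \<Rightarrow> nat \<Rightarrow> nat \<Rightarrow> (nat \<Rightarrow> nat) \<Rightarrow> nat" where
  "tuple_index p1 m1 p2 m2 x =
     (\<Sum>j=1..m1. x j * p1 ^ (j - 1)) + p1 ^ m1 * (\<Sum>j=1..m2. x (m1 + j) * p2 ^ (j - 1))"

definition tuple_of :: "nat \<Rightarrow> nat \<Rightarrow> nat \<Rightarrow> nat \<Rightarrow> nat \<Rightarrow> (nat \<Rightarrow> nat)" where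
  "tuple_of p1 m1 p2 m2 n =
     (THE x. x \<in> mixed_tuples p1 m1 p2 m2 \<and> tuple_index p1 m1 p2 m2 x = n)"

text \<open>
  The definite description is meaningful for \<open>n < p1 ^ m1 * p2 ^ m2\<close>:
  see \<open>tuple_of_in\<close> and \<open>tuple_index_tuple_of\<close> below.
\<close>

lemma radix_sum_less:
  fixes p :: nat
  assumes "\<And>j. j \<in> {1..m} \<Longrightarrow> x j < p"
  shows "(\<Sum>j=1..m. x j * p ^ (j - 1)) < p ^ m"
  using assms
proof (induction m)
  case (Suc m)
  have "(\<Sum>j=1..m. x j * p ^ (j - 1)) < p ^ m"
    using Suc by simp
  moreover have "Suc (x (Suc m)) * p ^ m \<le> p * p ^ m"
    using Suc.prems[of "Suc m"] by (intro mult_right_mono) auto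
  ultimately show ?case by simp
qed simp

lemma mult_add_less_unique:
  fixes a b c d k :: nat
  assumes "a < k" "b < k" "a + k * c = b + k * d"
  shows "a = b \<and> c = d"
proof -
  have "a = (a + k * c) mod k" "(b + k * d) mod k = b"
    using assms(1,2) by simp_all
  hence "a = b" using assms(3) by argo
  thus ?thesis using assms by simp
qed

lemma radix_sum_inj:
  fixes p :: nat
  assumes "\<And>j. j \<in> {1..m} \<Longrightarrow> x j < p" "\<And>j. j \<in> {1..m} \<Longrightarrow> y j < p"
    and "(\<Sum>j=1..m. x j * p ^ (j - 1)) = (\<Sum>j=1..m. y j * p ^ (j - 1))"
  shows "\<forall>j\<in>{1..m}. x j = y j"
  using assms
proof (induction m)
  case (Suc m)
  have x: "(\<Sum>j=1..m. x j * p ^ (j - 1)) < p ^ m" and y: "(\<Sum>j=1..m. y j * p ^ (j - 1)) < p ^ m"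
    using Suc.prems by (intro radix_sum_less; simp)+
  have eq: "(\<Sum>j=1..m. x j * p ^ (j - 1)) = (\<Sum>j=1..m. y j * p ^ (j - 1)) \<and> x (Suc m) = y (Suc m)"
    using Suc.prems(3) by (intro mult_add_less_unique[OF x y]) (simp add: mult.commute)
  hence "\<forall>j\<in>{1..m}. x j = y j" using Suc by simp
  with eq show ?case by (auto simp: atLeastAtMostSuc_conv)
qed simp

lemma bij_betw_tuple_index:
  "bij_betw (tuple_index p1 m1 p2 m2) (mixed_tuples p1 m1 p2 m2) {..<p1 ^ m1 * p2 ^ m2}"
proof -
  let ?D = "mixed_tuples p1 m1 p2 m2" and ?ix = "tuple_index p1 m1 p2 m2"
  let ?u = "\<lambda>x::nat\<Rightarrow>nat. \<Sum>j=1..m1. x j * p1 ^ (j - 1)"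
  let ?v = "\<lambda>x::nat\<Rightarrow>nat. \<Sum>j=1..m2. x (m1 + j) * p2 ^ (j - 1)"
  have D1: "x j < p1" if "x \<in> ?D" "j \<in> {1..m1}" for x j
    using PiE_mem[OF that(1)[unfolded mixed_tuples_def], of j] that(2) by simp
  have D2: "x (m1 + j) < p2" if "x \<in> ?D" "j \<in> {1..m2}" for x j
    using PiE_mem[OF that(1)[unfolded mixed_tuples_def], of "m1 + j"] that(2) by simp
  have u: "?u x < p1 ^ m1" and v: "?v x < p2 ^ m2" if "x \<in> ?D" for x
    using radix_sum_less[of m1 x p1] radix_sum_less[of m2 "\<lambda>j. x (m1 + j)" p2] D1 D2 that by auto
  have inj: "inj_on ?ix ?D"
  proof (rule inj_onI)
    fix x y assume xy: "x \<in> ?D" "y \<in> ?D" and "?ix x = ?ix y"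
    hence "?u x = ?u y \<and> ?v x = ?v y"
      by (intro mult_add_less_unique[OF u u]) (simp_all add: tuple_index_def)
    hence 1: "\<forall>j\<in>{1..m1}. x j = y j" and 2: "\<forall>j\<in>{1..m2}. x (m1 + j) = y (m1 + j)"
      using xy D1 D2 radix_sum_inj[of m1 x p1 y]
        radix_sum_inj[of m2 "\<lambda>j. x (m1 + j)" p2 "\<lambda>j. y (m1 + j)"] by auto
    have "x j = y j" if "j \<in> {1..m1+m2}" for j
    proof (cases "j \<le> m1")
      case True thus ?thesis using 1 that by simp
    next
      case False
      hence "j - m1 \<in> {1..m2}" "m1 + (j - m1) = j" using that by auto
      thus ?thesis using 2 by metis
    qed
    thus "x = y"
      using xy unfolding mixed_tuples_def by (intro PiE_ext[of x _ _ y]) auto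
  qed
  have le: "?ix ` ?D \<subseteq> {..<p1 ^ m1 * p2 ^ m2}"
  proof safe
    fix x assume x: "x \<in> ?D"
    have "p1 ^ m1 * Suc (?v x) \<le> p1 ^ m1 * p2 ^ m2"
      using v[OF x] by (intro mult_left_mono) auto
    thus "?ix x < p1 ^ m1 * p2 ^ m2"
      using u[OF x] by (simp add: tuple_index_def)
  qed
  have split: "{1..m1+m2} = {1..m1} \<union> {m1+1..m1+m2}" by auto
  have "card ?D = (\<Prod>j\<in>{1..m1+m2}. if j \<le> m1 then p1 else p2)"
    unfolding mixed_tuples_def by (subst card_PiE) (auto intro!: prod.cong)
  also have "\<dots> = (\<Prod>j\<in>{1..m1}. if j \<le> m1 then p1 else p2) * (\<Prod>j\<in>{m1+1..m1+m2}. if j \<le> m1 then p1 else p2)"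
    unfolding split by (rule prod.union_disjoint) auto
  also have "\<dots> = p1 ^ m1 * p2 ^ m2" by simp
  finally have "card (?ix ` ?D) = card {..<p1 ^ m1 * p2 ^ m2}"
    using card_image[OF inj] by simp
  hence "?ix ` ?D = {..<p1 ^ m1 * p2 ^ m2}"
    using le by (intro card_subset_eq) auto
  thus ?thesis using inj by (simp add: bij_betw_def)
qed

lemma ex1_tuple:
  assumes "n < p1 ^ m1 * p2 ^ m2"
  shows "\<exists>!x. x \<in> mixed_tuples p1 m1 p2 m2 \<and> tuple_index p1 m1 p2 m2 x = n"
proof -
  have "n \<in> tuple_index p1 m1 p2 m2 ` mixed_tuples p1 m1 p2 m2"
    using bij_betw_imp_surj_on[OF bij_betw_tuple_index[of p1 m1 p2 m2]] assms by simp
  thus ?thesis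
    using inj_onD[OF bij_betw_imp_inj_on[OF bij_betw_tuple_index[of p1 m1 p2 m2]]] by blast
qed

lemma tuple_of_in:
  assumes "n < p1 ^ m1 * p2 ^ m2"
  shows "tuple_of p1 m1 p2 m2 n \<in> mixed_tuples p1 m1 p2 m2"
  using theI'[OF ex1_tuple[OF assms]] unfolding tuple_of_def by blast

lemma tuple_index_tuple_of:
  assumes "n < p1 ^ m1 * p2 ^ m2"
  shows "tuple_index p1 m1 p2 m2 (tuple_of p1 m1 p2 m2 n) = n"
  using theI'[OF ex1_tuple[OF assms]] unfolding tuple_of_def by blast

definition psi :: "nat \<Rightarrow> nat \<Rightarrow> nat \<Rightarrow> nat \<Rightarrow> nat \<Rightarrow> ((nat \<Rightarrow> nat) \<Rightarrow> nat) \<Rightarrow> complex list" where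
  "psi q p1 m1 p2 m2 F =
     map (\<lambda>n. xi q ^ F (tuple_of p1 m1 p2 m2 n)) [0..<p1 ^ m1 * p2 ^ m2]"

text \<open>Intended for sequences of equal length \<open>L\<close> and \<open>\<bar>\<tau>\<bar> < L\<close>.\<close>

definition aperiodic_corr :: "complex list \<Rightarrow> complex list \<Rightarrow> int \<Rightarrow> complex" where
  "aperiodic_corr a b \<tau> =
     (if 0 \<le> \<tau>
      then \<Sum>s<length a - nat \<tau>. a ! s * cnj (b ! (s + nat \<tau>))
      else \<Sum>s<length a - nat (- \<tau>). a ! (s + nat (- \<tau>)) * cnj (b ! s))"

definition code_corr :: "complex list list \<Rightarrow> complex list list \<Rightarrow> int \<Rightarrow> complex" where
  "code_corr C D \<tau> = (\<Sum>l<length C. aperiodic_corr (C ! l) (D ! l) \<tau>)"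

definition is_CCC :: "nat \<Rightarrow> nat \<Rightarrow> complex list list list \<Rightarrow> bool" where
  "is_CCC M L Cs \<longleftrightarrow>
     length Cs = M \<and>
     (\<forall>C\<in>set Cs. length C = M \<and> (\<forall>c\<in>set C. length c = L)) \<and>
     (\<forall>k1<M. \<forall>k2<M. \<forall>\<tau>::int. \<bar>\<tau>\<bar> < int L \<longrightarrow>
        code_corr (Cs ! k1) (Cs ! k2) \<tau> = (if \<tau> = 0 \<and> k1 = k2 then of_nat (M * L) else 0))"

text \<open>
  The code with parameters \<open>t1\<close>, \<open>t2\<close> built on the function \<open>f\<close>, where \<open>q = p1 * p2\<close>;
  its sequences are indexed by the pairs \<open>(d1, d2)\<close> in lexicographic order.
\<close>

definition code_of ::
  "nat \<Rightarrow> nat \<Rightarrow> nat \<Rightarrow> nat \<Rightarrow> nat \<Rightarrow> ((nat \<Rightarrow> nat) \<Rightarrow> nat) \<Rightarrow> (nat \<Rightarrow> nat) \<Rightarrow> (nat \<Rightarrow> nat)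
     \<Rightarrow> nat \<Rightarrow> nat \<Rightarrow> complex list list" where
  "code_of q p1 m1 p2 m2 f \<pi> \<pi>' t1 t2 =
     map (\<lambda>(d1, d2). psi q p1 m1 p2 m2
            (\<lambda>x. (f x + (q div p1) * (d1 * x (\<pi> 1) + t1 * x (\<pi> m1))
                      + (q div p2) * (d2 * x (\<pi>' (m1 + 1)) + t2 * x (\<pi>' (m1 + m2)))) mod q))
         (List.product [0..<p1] [0..<p2])"

end

theory Submission
  imports Defs "HOL-Analysis.Complex_Transcendental"
begin

text \<open>
  Replace each sequence by its generating polynomial on the unit circle: the correlation
  conditions say that the polynomials, arranged in a square matrix indexed by \<open>(d1, d2)\<close> and
  \<open>(t1, t2)\<close>, have orthogonal columns at every point. Up to Fourier matrices on both sides,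
  this matrix is a product of unimodular diagonal matrices and of the transfer matrices with
  entries \<open>\<xi>\<^sub>p\<close> to the power \<open>\<phi>(a) \<phi>'(b)\<close>, one for each product term of \<open>f\<close>; the term with
  factor \<open>\<lambda>\<close> enters as a diagonal phase between the two chains. If \<open>\<phi>\<close> and \<open>\<phi>'\<close> permute the
  residues, the transfer matrix is a multiple of a unitary one, which gives sufficiency.
  Otherwise it has a null vector; taking the singular factor furthest to the right, this vector
  pulls back through the invertible factors behind it to a null vector of the whole product, so
  orthogonality already fails at the point 1.
\<close>

section \<open>Roots of unity\<close>

lemma norm_xi [simp]: "norm (xi q) = 1"
proof -
  have "xi q = exp (\<i> * of_real (2 * pi / of_nat q))"
    by (simp add: xi_def mult_ac)
  thus ?thesis by (simp only: norm_exp_i_times)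
qed

lemma xi_nonzero [simp]: "xi q \<noteq> 0"
  by (simp add: xi_def)

lemma cnj_unimodular: "norm z = 1 \<Longrightarrow> z * cnj z = 1"
  by (simp add: complex_norm_square[symmetric])

lemma cnj_xi: "cnj (xi q) = inverse (xi q)"
  using cnj_unimodular[OF norm_xi[of q]] by (metis inverse_unique)

lemma xi_power_div:
  assumes "p dvd q" "q > 0"
  shows "xi q ^ (q div p) = xi p"
proof -
  from assms obtain r where r: "q = p * r" by blast
  with assms have "p > 0" "r > 0" by auto
  thus ?thesis unfolding xi_def r by (simp add: exp_of_nat_mult[symmetric])
qed

lemma xi_power_self: "q > 0 \<Longrightarrow> xi q ^ q = 1"
  unfolding xi_def by (simp add: exp_of_nat_mult[symmetric])

lemma xi_power_eq_1_iff:
  assumes "q > 0"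
  shows "xi q ^ k = 1 \<longleftrightarrow> q dvd k"
proof
  assume "q dvd k"
  thus "xi q ^ k = 1" using xi_power_self[OF assms] by (auto simp: power_mult)
next
  assume "xi q ^ k = 1"
  hence "exp (of_real (2 * pi * k / q) * \<i>) = 1"
    unfolding xi_def by (simp add: exp_of_nat_mult[symmetric] mult_ac)
  then obtain n :: int where "2 * pi * k / q = of_int (2 * n) * pi"
    by (auto simp: exp_eq_1)
  hence "real k = real_of_int (n * int q)"
    using assms by (simp add: field_simps)
  hence "int k = n * int q"
    by linarith
  thus "q dvd k"
    by (metis dvd_triv_right int_dvd_int_iff)
qed

lemma xi_power_eq_iff:
  assumes "q > 0"
  shows "xi q ^ a = xi q ^ b \<longleftrightarrow> a mod q = b mod q"
proof (induction a b rule: linorder_wlog)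
  case (le a b)
  have "xi q ^ b = xi q ^ a * xi q ^ (b - a)"
    using le by (simp flip: power_add)
  hence "xi q ^ a = xi q ^ b \<longleftrightarrow> xi q ^ (b - a) = 1" by auto
  also have "\<dots> \<longleftrightarrow> b mod q = a mod q"
    using le assms by (simp add: xi_power_eq_1_iff mod_eq_dvd_iff_nat)
  finally show ?case by auto
qed auto

lemma xi_power_mod: "q > 0 \<Longrightarrow> xi q ^ (a mod q) = xi q ^ a"
  by (simp add: xi_power_eq_iff)

lemma sum_root_of_unity:
  fixes w :: complex
  assumes "w ^ p = 1"
  shows "(\<Sum>k<p. w ^ k) = (if w = 1 then of_nat p else 0)"
  using assms by (simp add: sum_gp_strict)

lemma xi_powi_eq_1_iff:
  assumes "\<bar>k\<bar> < int q"
  shows "xi q powi k = 1 \<longleftrightarrow> k = 0"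
proof -
  have "xi q powi k = 1 \<longleftrightarrow> int q dvd k"
    using assms by (cases k rule: int_cases2) (simp_all add: power_int_minus xi_power_eq_1_iff)
  thus ?thesis
    using assms dvd_imp_le_int[of k "int q"] by force
qed

section \<open>Aperiodic correlation and generating polynomials\<close>

definition gen_poly :: "complex list \<Rightarrow> complex \<Rightarrow> complex" where
  "gen_poly a z = (\<Sum>n<length a. a ! n * z ^ n)"

text \<open>Both sign cases of the shift merge into one indicator sum over pairs of positions, so
  that the Fourier arguments below need no case distinction.\<close>

lemma aperiodic_corr_eq_double_sum:
  assumes "length a = L" "length b = L" "\<bar>\<tau>\<bar> < int L"
  shows "aperiodic_corr a b \<tau> =
    (\<Sum>s<L. \<Sum>r<L. if int r - int s = \<tau> then a ! s * cnj (b ! r) else 0)"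
proof (cases "0 \<le> \<tau>")
  case True
  define k where "k = nat \<tau>"
  have "(\<Sum>r<L. if int r - int s = \<tau> then a ! s * cnj (b ! r) else 0) =
      (if s < L - k then a ! s * cnj (b ! (s + k)) else 0)" for s
  proof -
    have "(\<Sum>r<L. if int r - int s = \<tau> then a ! s * cnj (b ! r) else 0) =
        (\<Sum>r<L. if r = s + k then a ! s * cnj (b ! r) else 0)"
      using True by (intro sum.cong) (auto simp: k_def)
    thus ?thesis by (simp add: less_diff_conv)
  qed
  moreover have "{..<L} \<inter> {s. s < L - k} = {..<L - k}" by auto
  ultimately show ?thesis
    using True assms by (simp add: aperiodic_corr_def k_def[symmetric] sum.If_cases)
next
  case False
  define k where "k = nat (- \<tau>)"
  \<comment> \<open>For a negative shift the first position is the one determined by the other,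
    hence the exchange of summations at the end.\<close>
  have "(\<Sum>s<L. if int r - int s = \<tau> then a ! s * cnj (b ! r) else 0) =
      (if r < L - k then a ! (r + k) * cnj (b ! r) else 0)" for r
  proof -
    have "(\<Sum>s<L. if int r - int s = \<tau> then a ! s * cnj (b ! r) else 0) =
        (\<Sum>s<L. if s = r + k then a ! s * cnj (b ! r) else 0)"
      using False by (intro sum.cong) (auto simp: k_def)
    thus ?thesis by (simp add: less_diff_conv)
  qed
  moreover have "{..<L} \<inter> {s. s < L - k} = {..<L - k}" by auto
  ultimately show ?thesis
    using False assms
    by (subst sum.swap) (simp add: aperiodic_corr_def k_def[symmetric] sum.If_cases)
qed

text \<open>Fourier inversion on the roots of unity of order \<open>2 * L\<close>. This order
  suffices because \<open>\<tau> + s - r\<close> lies strictly between \<open>- 2 * L\<close> and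
  \<open>2 * L\<close>, so no nonzero difference is confused with 0.\<close>

lemma aperiodic_corr_inversion:
  assumes "length a = L" "length b = L" "\<bar>\<tau>\<bar> < int L"
  shows "of_nat (2 * L) * aperiodic_corr a b \<tau> =
    (\<Sum>k<2 * L. (xi (2 * L) powi \<tau>) ^ k *
       (gen_poly a (xi (2 * L) ^ k) * cnj (gen_poly b (xi (2 * L) ^ k))))"
proof -
  define w where "w = xi (2 * L)"
  have L: "2 * L > 0" using assms(3) by simp
  have [simp]: "w \<noteq> 0" and cnj_w: "cnj w = inverse w" by (simp_all add: w_def cnj_xi)
  have pow: "(w powi \<tau>) ^ k * ((w ^ k) ^ s * cnj ((w ^ k) ^ r)) = (w powi (\<tau> + int s - int r)) ^ k"
    for k s r :: nat
  proof -
    have "(w ^ k) ^ s = (w ^ s) ^ k" "cnj ((w ^ k) ^ r) = (cnj w ^ r) ^ k"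
      by (simp_all add: mult.commute flip: power_mult)
    thus ?thesis
      by (simp add: cnj_w power_int_diff power_int_add power_mult_distrib divide_inverse
          power_inverse mult_ac)
  qed
  have orth: "(\<Sum>k<2 * L. (w powi (\<tau> + int s - int r)) ^ k) =
      (if int r - int s = \<tau> then of_nat (2 * L) else 0)" if "s < L" "r < L" for s r
  proof -
    have "(w powi (\<tau> + int s - int r)) ^ (2 * L) = (w ^ (2 * L)) powi (\<tau> + int s - int r)"
      by (simp add: power_int_power' power_int_power mult_ac del: of_nat_mult)
    also have "\<dots> = 1" using xi_power_self[OF L] by (simp add: w_def)
    finally have 1: "(w powi (\<tau> + int s - int r)) ^ (2 * L) = 1" .
    have "w powi (\<tau> + int s - int r) = 1 \<longleftrightarrow> \<tau> + int s - int r = 0"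
      unfolding w_def using that assms(3) by (intro xi_powi_eq_1_iff) auto
    thus ?thesis using sum_root_of_unity[OF 1] by auto
  qed
  have "(\<Sum>k<2 * L. (w powi \<tau>) ^ k * (gen_poly a (w ^ k) * cnj (gen_poly b (w ^ k)))) =
      (\<Sum>k<2 * L. \<Sum>s<L. \<Sum>r<L. a ! s * cnj (b ! r) * (w powi (\<tau> + int s - int r)) ^ k)"
  proof (rule sum.cong[OF refl])
    fix k
    have "(w powi \<tau>) ^ k * (gen_poly a (w ^ k) * cnj (gen_poly b (w ^ k))) =
        (\<Sum>s<L. \<Sum>r<L. (w powi \<tau>) ^ k * (a ! s * (w ^ k) ^ s * cnj (b ! r * (w ^ k) ^ r)))"
      by (simp only: gen_poly_def assms(1,2) cnj_sum sum_product) (simp only: sum_distrib_left)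
    also have "\<dots> = (\<Sum>s<L. \<Sum>r<L. a ! s * cnj (b ! r) * (w powi (\<tau> + int s - int r)) ^ k)"
      by (simp only: pow[symmetric] complex_cnj_mult mult_ac)
    finally show "(w powi \<tau>) ^ k * (gen_poly a (w ^ k) * cnj (gen_poly b (w ^ k))) = \<dots>" .
  qed
  also have "\<dots> = (\<Sum>s<L. \<Sum>r<L. a ! s * cnj (b ! r) * (\<Sum>k<2 * L. (w powi (\<tau> + int s - int r)) ^ k))"
    by (subst sum.swap, rule sum.cong[OF refl], subst sum.swap) (simp add: sum_distrib_left)
  also have "\<dots> = (\<Sum>s<L. \<Sum>r<L. of_nat (2 * L) *
      (if int r - int s = \<tau> then a ! s * cnj (b ! r) else 0))"
    by (intro sum.cong refl) (simp add: orth)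
  also have "\<dots> = of_nat (2 * L) * aperiodic_corr a b \<tau>"
    unfolding aperiodic_corr_eq_double_sum[OF assms] by (simp add: sum_distrib_left)
  finally show ?thesis by (simp add: w_def)
qed

text \<open>Each pair of positions \<open>(s, r)\<close> is counted at exactly one shift, namely
  \<open>r - s\<close>, so the total over all shifts is the unrestricted double sum.\<close>

lemma sum_aperiodic_corr:
  assumes "length a = L" "length b = L"
  shows "(\<Sum>\<tau>\<in>{- int L<..<int L}. aperiodic_corr a b \<tau>) = gen_poly a 1 * cnj (gen_poly b 1)"
proof -
  have "(\<Sum>\<tau>\<in>{- int L<..<int L}. aperiodic_corr a b \<tau>) =
      (\<Sum>\<tau>\<in>{- int L<..<int L}. \<Sum>s<L. \<Sum>r<L. if int r - int s = \<tau> then a ! s * cnj (b ! r) else 0)"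
    by (intro sum.cong refl aperiodic_corr_eq_double_sum assms) auto
  also have "\<dots> = (\<Sum>s<L. \<Sum>r<L. \<Sum>\<tau>\<in>{- int L<..<int L}. if int r - int s = \<tau> then a ! s * cnj (b ! r) else 0)"
    by (subst sum.swap, subst sum.swap[of _ "{- int L<..<int L}" "{..<L}"]) simp
  also have "\<dots> = (\<Sum>s<L. \<Sum>r<L. a ! s * cnj (b ! r))"
    by (intro sum.cong refl) (auto simp: sum.delta' abs_less_iff)
  finally show ?thesis by (simp add: gen_poly_def assms sum_product)
qed

lemma corr_imp_gen_poly_orthogonal:
  assumes len: "\<And>d. d \<in> X \<Longrightarrow> length (a d) = L \<and> length (b d) = L" and "L > 0"
    and corr: "\<And>\<tau>. \<bar>\<tau>\<bar> < int L \<Longrightarrow> (\<Sum>d\<in>X. aperiodic_corr (a d) (b d) \<tau>) = (if \<tau> = 0 then c else 0)"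
  shows "(\<Sum>d\<in>X. gen_poly (a d) 1 * cnj (gen_poly (b d) 1)) = c"
proof -
  have "(\<Sum>d\<in>X. gen_poly (a d) 1 * cnj (gen_poly (b d) 1)) =
      (\<Sum>d\<in>X. \<Sum>\<tau>\<in>{- int L<..<int L}. aperiodic_corr (a d) (b d) \<tau>)"
    using len by (intro sum.cong refl sum_aperiodic_corr[symmetric]) auto
  also have "\<dots> = (\<Sum>\<tau>\<in>{- int L<..<int L}. \<Sum>d\<in>X. aperiodic_corr (a d) (b d) \<tau>)"
    by (rule sum.swap)
  also have "\<dots> = (\<Sum>\<tau>\<in>{- int L<..<int L}. if \<tau> = 0 then c else 0)"
    by (intro sum.cong refl corr) auto
  finally show ?thesis using \<open>L > 0\<close> by simp
qed

text \<open>By inversion the correlations are the Fourier coefficients of a function that is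
  constant on the unit circle; only the coefficient at shift 0 survives.\<close>

lemma gen_poly_orthogonal_imp_corr:
  assumes len: "\<And>d. d \<in> X \<Longrightarrow> length (a d) = L \<and> length (b d) = L"
    and orth: "\<And>z. norm z = 1 \<Longrightarrow> (\<Sum>d\<in>X. gen_poly (a d) z * cnj (gen_poly (b d) z)) = c"
    and \<tau>: "\<bar>\<tau>\<bar> < int L"
  shows "(\<Sum>d\<in>X. aperiodic_corr (a d) (b d) \<tau>) = (if \<tau> = 0 then c else 0)"
proof -
  define w where "w = xi (2 * L)"
  have L: "2 * L > 0" using \<tau> by simp
  have "of_nat (2 * L) * (\<Sum>d\<in>X. aperiodic_corr (a d) (b d) \<tau>) =
      (\<Sum>d\<in>X. \<Sum>k<2 * L. (w powi \<tau>) ^ k * (gen_poly (a d) (w ^ k) * cnj (gen_poly (b d) (w ^ k))))"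
    unfolding sum_distrib_left w_def using len \<tau>
    by (intro sum.cong refl aperiodic_corr_inversion) auto
  also have "\<dots> = (\<Sum>k<2 * L. (w powi \<tau>) ^ k *
      (\<Sum>d\<in>X. gen_poly (a d) (w ^ k) * cnj (gen_poly (b d) (w ^ k))))"
    by (subst sum.swap) (simp add: sum_distrib_left)
  also have "\<dots> = (\<Sum>k<2 * L. (w powi \<tau>) ^ k) * c"
    by (simp add: orth w_def norm_power sum_distrib_right)
  also have "(\<Sum>k<2 * L. (w powi \<tau>) ^ k) = (if \<tau> = 0 then of_nat (2 * L) else 0)"
  proof -
    have "(w powi \<tau>) ^ (2 * L) = (w ^ (2 * L)) powi \<tau>"
      by (simp add: power_int_power' power_int_power mult_ac del: of_nat_mult)
    hence "(w powi \<tau>) ^ (2 * L) = 1" using xi_power_self[OF L] by (simp add: w_def)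
    moreover have "w powi \<tau> = 1 \<longleftrightarrow> \<tau> = 0"
      unfolding w_def using \<tau> by (intro xi_powi_eq_1_iff) simp
    ultimately show ?thesis using sum_root_of_unity by auto
  qed
  finally have "of_nat (2 * L) * (\<Sum>d\<in>X. aperiodic_corr (a d) (b d) \<tau>) =
      of_nat (2 * L) * (if \<tau> = 0 then c else 0)" by simp
  thus ?thesis using L by (simp only: mult_left_cancel of_nat_eq_0_iff)
qed

section \<open>Transfer matrices\<close>

text \<open>With both functions the identity this is the discrete Fourier matrix of order
  \<open>p\<close>. In general its rows and columns are selected by \<open>f\<close> and
  \<open>f'\<close> modulo \<open>p\<close>, possibly with repetitions.\<close>

definition phase_kernel :: "nat \<Rightarrow> (nat \<Rightarrow> nat) \<Rightarrow> (nat \<Rightarrow> nat) \<Rightarrow> nat \<Rightarrow> nat \<Rightarrow> complex" where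
  "phase_kernel p f f' a b = xi p ^ (f a * f' b)"

lemma kernel_transpose: "phase_kernel p f f' a b = phase_kernel p f' f b a"
  by (simp add: phase_kernel_def mult.commute)

lemma permutes_mod_ident [simp]: "permutes_mod p (\<lambda>u. u)"
proof -
  have "bij_betw (\<lambda>u. u mod p) {0..<p} {0..<p} = bij_betw id {0..<p} {0..<p}"
    by (rule bij_betw_cong) simp
  thus ?thesis by (simp add: permutes_mod_def bij_betw_id)
qed

lemma permutes_mod_iff_inj:
  assumes "p > 0"
  shows "permutes_mod p f \<longleftrightarrow> inj_on (\<lambda>u. f u mod p) {0..<p}"
proof -
  have "(\<lambda>u. f u mod p) ` {0..<p} \<subseteq> {0..<p}" using assms by auto
  from endo_inj_surj[OF _ this] show ?thesis by (auto simp only: permutes_mod_def bij_betw_def finite_atLeastLessThan)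
qed

text \<open>Exponents of a \<open>p\<close>-th root of unity matter only modulo \<open>p\<close>, so
  the sum is a rearranged geometric sum.\<close>

lemma sum_power_permutes_mod:
  fixes w :: complex
  assumes f: "permutes_mod p f" and w: "w ^ p = 1"
  shows "(\<Sum>a<p. w ^ f a) = (if w = 1 then of_nat p else 0)"
proof -
  have red: "w ^ k = w ^ (k mod p)" for k
  proof -
    have "w ^ k = w ^ (p * (k div p) + k mod p)" by simp
    also have "\<dots> = w ^ (k mod p)" unfolding power_add power_mult w by simp
    finally show ?thesis .
  qed
  have "(\<Sum>a<p. w ^ f a) = (\<Sum>a\<in>{0..<p}. w ^ (f a mod p))"
    using red by (simp add: lessThan_atLeast0)
  also have "\<dots> = (\<Sum>k\<in>{0..<p}. w ^ k)"
    using sum.reindex_bij_betw[OF f[unfolded permutes_mod_def], of "\<lambda>k. w ^ k"] .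
  finally show ?thesis using sum_root_of_unity[OF w] by (simp add: lessThan_atLeast0)
qed

text \<open>The product of two columns is a character sum over the values of \<open>f\<close> with
  ratio \<open>w\<close>. Since \<open>f'\<close> is injective modulo \<open>p\<close>, this ratio
  is 1 only on the diagonal.\<close>

lemma kernel_orthogonal:
  assumes "permutes_mod p f" "permutes_mod p f'" "b < p" "b' < p"
  shows "(\<Sum>a<p. phase_kernel p f f' a b * cnj (phase_kernel p f f' a b')) = (if b = b' then of_nat p else 0)"
proof -
  have p: "p > 0" using assms by simp
  define w where "w = xi p ^ f' b * cnj (xi p ^ f' b')"
  have "phase_kernel p f f' a b * cnj (phase_kernel p f f' a b') = w ^ f a" for a
    by (simp add: phase_kernel_def w_def power_mult_distrib mult.commute flip: power_mult)
  moreover have "w ^ p = 1"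
  proof -
    have "w ^ p = (xi p ^ p) ^ f' b * cnj ((xi p ^ p) ^ f' b')"
      by (simp add: w_def power_mult_distrib mult.commute flip: power_mult)
    thus ?thesis using xi_power_self[OF p] by simp
  qed
  moreover have "w = 1 \<longleftrightarrow> b = b'"
  proof -
    have "w = 1 \<longleftrightarrow> xi p ^ f' b = xi p ^ f' b'"
      by (simp add: w_def cnj_xi power_inverse field_simps)
    also have "\<dots> \<longleftrightarrow> f' b mod p = f' b' mod p"
      by (rule xi_power_eq_iff[OF p])
    also have "\<dots> \<longleftrightarrow> b = b'"
      using inj_on_eq_iff[OF bij_betw_imp_inj_on[OF assms(2)[unfolded permutes_mod_def]], of b b'] assms(3,4)
      by simp
    finally show ?thesis .
  qed
  ultimately show ?thesis using sum_power_permutes_mod[OF assms(1)] by simp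
qed

lemma orthogonal_columns_isometry:
  fixes T :: "nat \<Rightarrow> nat \<Rightarrow> complex"
  assumes "\<And>b b'. b < p \<Longrightarrow> b' < p \<Longrightarrow> (\<Sum>a<p. T a b * cnj (T a b')) = (if b = b' then of_nat p else 0)"
  shows "(\<Sum>a<p. (\<Sum>b<p. T a b * c b) * cnj (\<Sum>b<p. T a b * c' b)) =
    of_nat p * (\<Sum>b<p. c b * cnj (c' b))"
proof -
  have "(\<Sum>a<p. (\<Sum>b<p. T a b * c b) * cnj (\<Sum>b<p. T a b * c' b)) =
      (\<Sum>a<p. \<Sum>b<p. \<Sum>b'<p. c b * cnj (c' b') * (T a b * cnj (T a b')))"
    by (simp add: sum_product mult_ac)
  also have "\<dots> = (\<Sum>b<p. \<Sum>b'<p. c b * cnj (c' b') * (\<Sum>a<p. T a b * cnj (T a b')))"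
    by (subst sum.swap, rule sum.cong[OF refl], subst sum.swap) (simp add: sum_distrib_left)
  also have "\<dots> = (\<Sum>b<p. \<Sum>b'<p. if b' = b then c b * cnj (c' b') * of_nat p else 0)"
    by (intro sum.cong refl) (simp add: assms)
  finally show ?thesis by (simp add: sum_distrib_left mult_ac)
qed

lemmas kernel_isometry =
  orthogonal_columns_isometry[where T = "phase_kernel p f f'" for p f f', OF kernel_orthogonal]

lemma kernel_surjective:
  assumes "permutes_mod p f" "permutes_mod p f'"
  shows "\<exists>c. \<forall>a<p. (\<Sum>b<p. phase_kernel p f f' a b * c b) = r a"
proof (intro exI allI impI)
  fix a assume a: "a < p"
  \<comment> \<open>The preimage comes from the conjugate transpose divided by \<open>p\<close>. As
    a right inverse it needs orthogonal rows, which are the orthogonal columns of the transposed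
    kernel.\<close>
  let ?c = "\<lambda>b. (\<Sum>a'<p. cnj (phase_kernel p f f' a' b) * r a') / of_nat p"
  have "(\<Sum>b<p. phase_kernel p f f' a b * ?c b) =
      (\<Sum>b<p. \<Sum>a'<p. r a' / of_nat p * (phase_kernel p f f' a b * cnj (phase_kernel p f f' a' b)))"
    by (simp add: sum_distrib_left sum_divide_distrib mult_ac)
  also have "\<dots> = (\<Sum>a'<p. r a' / of_nat p * (\<Sum>b<p. phase_kernel p f f' a b * cnj (phase_kernel p f f' a' b)))"
    by (subst sum.swap) (simp add: sum_distrib_left)
  also have "\<dots> = (\<Sum>a'<p. if a' = a then r a' else 0)"
    using a by (intro sum.cong refl)
      (simp add: kernel_transpose[of p f f'] kernel_orthogonal[OF assms(2,1)])
  finally show "(\<Sum>b<p. phase_kernel p f f' a b * ?c b) = r a"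
    using a by simp
qed

text \<open>If \<open>f'\<close> identifies two residues, two columns coincide. Otherwise \<open>f\<close> omits a residue
  \<open>k\<close>, and the character of frequency \<open>-k\<close> is annihilated.\<close>

lemma kernel_null_vector:
  assumes p: "p > 0" and not: "\<not> (permutes_mod p f \<and> permutes_mod p f')"
  shows "\<exists>c. (\<exists>b<p. c b \<noteq> 0) \<and> (\<forall>a<p. (\<Sum>b<p. phase_kernel p f f' a b * c b) = 0)"
proof (cases "permutes_mod p f'")
  case False
  then obtain b1 b2 where b: "b1 < p" "b2 < p" "b1 \<noteq> b2" "f' b1 mod p = f' b2 mod p"
    by (auto simp: permutes_mod_iff_inj[OF p] inj_on_def)
  have eq: "phase_kernel p f f' a b1 = phase_kernel p f f' a b2" for a
    unfolding phase_kernel_def xi_power_eq_iff[OF p] by (rule mod_mult_cong[OF refl b(4)])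
  define c where "c = (\<lambda>b. (if b = b1 then 1 else 0) - (if b = b2 then 1 else 0) :: complex)"
  have "(\<Sum>b<p. phase_kernel p f f' a b * c b) = 0" for a
  proof -
    have "(\<Sum>b<p. phase_kernel p f f' a b * c b) =
        (\<Sum>b<p. (if b = b1 then phase_kernel p f f' a b else 0)) - (\<Sum>b<p. (if b = b2 then phase_kernel p f f' a b else 0))"
      unfolding sum_subtractf[symmetric] by (intro sum.cong) (auto simp: c_def)
    thus ?thesis using b eq by simp
  qed
  moreover have "c b1 \<noteq> 0" using b by (simp add: c_def)
  ultimately show ?thesis using b(1) by blast
next
  case True
  with not have "\<not> inj_on (\<lambda>u. f u mod p) {0..<p}" by (simp add: permutes_mod_iff_inj[OF p])
  hence "(\<lambda>u. f u mod p) ` {0..<p} \<noteq> {0..<p}"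
    using eq_card_imp_inj_on[of "{0..<p}" "\<lambda>u. f u mod p"] by auto
  moreover have "(\<lambda>u. f u mod p) ` {0..<p} \<subseteq> {0..<p}" using p by auto
  ultimately obtain k where "k \<in> {0..<p}" "k \<notin> (\<lambda>u. f u mod p) ` {0..<p}" by blast
  hence k: "k < p" "\<And>u. u < p \<Longrightarrow> f u mod p \<noteq> k" by auto
  define c where "c = (\<lambda>b. cnj (xi p ^ (k * f' b)))"
  have "(\<Sum>b<p. phase_kernel p f f' a b * c b) = 0" if a: "a < p" for a
  proof -
    \<comment> \<open>Pairing row \<open>a\<close> with \<open>c\<close> gives a character sum over
      the permutation \<open>f'\<close> with ratio \<open>w\<close>; because \<open>f\<close> omits
      \<open>k\<close>, this ratio differs from 1 and the sum vanishes.\<close>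
    define w where "w = xi p ^ f a * cnj (xi p ^ k)"
    have "phase_kernel p f f' a b * c b = w ^ f' b" for b
      by (simp add: phase_kernel_def c_def w_def power_mult_distrib power_mult)
    moreover have "w ^ p = 1"
    proof -
      have "w ^ p = (xi p ^ p) ^ f a * cnj ((xi p ^ p) ^ k)"
        by (simp add: w_def power_mult_distrib mult.commute flip: power_mult)
      thus ?thesis using xi_power_self[OF p] by simp
    qed
    moreover have "w \<noteq> 1"
    proof
      assume "w = 1"
      hence "xi p ^ f a = xi p ^ k" by (simp add: w_def cnj_xi power_inverse field_simps)
      thus False using k a by (simp add: xi_power_eq_iff[OF p])
    qed
    ultimately show ?thesis using sum_power_permutes_mod[OF True, of w] by simp
  qed
  moreover have "c 0 \<noteq> 0" by (simp add: c_def)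
  ultimately show ?thesis using p by blast
qed

section \<open>Products of transfer matrices\<close>

text \<open>\<open>chain p T D n\<close> is the operator \<open>D\<^sub>1 T\<^sub>1 D\<^sub>2 T\<^sub>2 \<dots> T\<^sub>n D\<^sub>n\<^sub>+\<^sub>1\<close> with diagonal matrices \<open>D\<^sub>i\<close>.\<close>

primrec chain :: "nat \<Rightarrow> (nat \<Rightarrow> nat \<Rightarrow> nat \<Rightarrow> complex) \<Rightarrow> (nat \<Rightarrow> nat \<Rightarrow> complex) \<Rightarrow> nat
    \<Rightarrow> (nat \<Rightarrow> complex) \<Rightarrow> nat \<Rightarrow> complex" where
  "chain p T D 0 c = (\<lambda>u. D 1 u * c u)"
| "chain p T D (Suc n) c = chain p T D n (\<lambda>a. \<Sum>b<p. T (Suc n) a b * (D (Suc (Suc n)) b * c b))"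

lemma chain_cong:
  assumes "\<And>a. a < p \<Longrightarrow> c a = c' a" "u < p"
  shows "chain p T D n c u = chain p T D n c' u"
proof (cases n)
  case (Suc k)
  have "(\<lambda>a. \<Sum>b<p. T (Suc k) a b * (D (Suc (Suc k)) b * c b)) =
      (\<lambda>a. \<Sum>b<p. T (Suc k) a b * (D (Suc (Suc k)) b * c' b))"
    using assms(1) by (intro ext sum.cong) auto
  thus ?thesis using Suc by simp
qed (use assms in simp)

lemma chain_sum:
  "chain p T D n (\<lambda>a. \<Sum>t\<in>S. k t * c t a) u = (\<Sum>t\<in>S. k t * chain p T D n (c t) u)"
proof (induction n arbitrary: c)
  case (Suc n)
  have "(\<lambda>a. \<Sum>b<p. T (Suc n) a b * (D (Suc (Suc n)) b * (\<Sum>t\<in>S. k t * c t b))) =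
      (\<lambda>a. \<Sum>t\<in>S. k t * (\<Sum>b<p. T (Suc n) a b * (D (Suc (Suc n)) b * c t b)))"
    unfolding sum_distrib_left by (subst sum.swap) (simp add: mult_ac)
  thus ?case using Suc by simp
qed (simp add: sum_distrib_left mult_ac)

lemma chain_zero: "chain p T D n (\<lambda>_. 0) u = 0"
  using chain_sum[where S = "{}"] by simp

lemma sum_PiE_insert:
  assumes "k \<notin> I"
  shows "(\<Sum>x\<in>PiE (insert k I) B. h x) = (\<Sum>x\<in>PiE I B. \<Sum>b\<in>B k. h (x(k := b)))"
proof -
  have "(\<Sum>x\<in>PiE (insert k I) B. h x) = (\<Sum>(b, x)\<in>B k \<times> PiE I B. h (x(k := b)))"
    unfolding PiE_insert_eq using assms
    by (subst sum.reindex[OF inj_combinator]) (auto simp: case_prod_unfold)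
  also have "\<dots> = (\<Sum>b\<in>B k. \<Sum>x\<in>PiE I B. h (x(k := b)))"
    by (simp add: sum.cartesian_product)
  also have "\<dots> = (\<Sum>x\<in>PiE I B. \<Sum>b\<in>B k. h (x(k := b)))"
    by (rule sum.swap)
  finally show ?thesis .
qed

text \<open>Here \<open>x\<close> is a path of states with edge weights \<open>T i\<close> and
  vertex weights \<open>D i\<close>, as in the transfer-matrix method.\<close>

definition path_weight :: "(nat \<Rightarrow> nat \<Rightarrow> nat \<Rightarrow> complex) \<Rightarrow> (nat \<Rightarrow> nat \<Rightarrow> complex) \<Rightarrow> nat
    \<Rightarrow> (nat \<Rightarrow> nat) \<Rightarrow> complex" where
  "path_weight T D n x = (\<Prod>i=1..n. T i (x i) (x (i + 1))) * (\<Prod>i=1..n + 1. D i (x i))"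

text \<open>Summing out the last vertex absorbs it into the boundary vector. This is why
  \<open>c\<close> stays arbitrary in the induction and why \<open>chain\<close> recurses at its
  right end.\<close>

lemma sum_path_weight:
  "(\<Sum>x\<in>{1..n + 1} \<rightarrow>\<^sub>E {..<p}. s (x 1) * path_weight T D n x * c (x (n + 1))) =
    (\<Sum>u<p. s u * chain p T D n c u)"
proof (induction n arbitrary: c)
  case 0
  show ?case
    using sum_PiE_insert[of "1::nat" "{}" "\<lambda>x. s (x 1) * (D 1 (x 1) * c (x 1))" "\<lambda>_. {..<p}"]
    by (simp add: path_weight_def mult.assoc)
next
  case (Suc n)
  have I: "{1..Suc n + 1} = insert (n + 2) {1..n + 1}" by auto
  have upd: "path_weight T D (Suc n) (x(n + 2 := b)) =
      path_weight T D n x * (T (n + 1) (x (n + 1)) b * D (n + 2) b)" for x b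
  proof -
    let ?y = "x(n + 2 := b)"
    have "(\<Prod>i=1..n. T i (?y i) (?y (i + 1))) = (\<Prod>i=1..n. T i (x i) (x (i + 1)))"
      by (intro prod.cong) auto
    moreover have "(\<Prod>i=1..n + 1. D i (?y i)) = (\<Prod>i=1..n + 1. D i (x i))"
      by (intro prod.cong) auto
    moreover have "path_weight T D (Suc n) ?y =
        (\<Prod>i=1..n. T i (?y i) (?y (i + 1))) * T (n + 1) (?y (n + 1)) (?y (n + 2)) *
        ((\<Prod>i=1..n + 1. D i (?y i)) * D (n + 2) (?y (n + 2)))"
      by (simp add: path_weight_def)
    ultimately show ?thesis by (simp add: path_weight_def mult_ac)
  qed
  have "(\<Sum>x\<in>{1..Suc n + 1} \<rightarrow>\<^sub>E {..<p}. s (x 1) * path_weight T D (Suc n) x * c (x (Suc n + 1))) =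
      (\<Sum>x\<in>{1..n + 1} \<rightarrow>\<^sub>E {..<p}. \<Sum>b<p. s (x 1) * path_weight T D (Suc n) (x(n + 2 := b)) * c b)"
    unfolding I by (subst sum_PiE_insert) auto
  also have "\<dots> = (\<Sum>x\<in>{1..n + 1} \<rightarrow>\<^sub>E {..<p}. s (x 1) * path_weight T D n x *
      (\<Sum>b<p. T (n + 1) (x (n + 1)) b * (D (n + 2) b * c b)))"
    by (simp only: upd sum_distrib_left mult_ac)
  also have "\<dots> = (\<Sum>u<p. s u * chain p T D (Suc n) c u)"
    by (subst Suc) simp
  finally show ?case .
qed

text \<open>Each kernel scales inner products by \<open>p\<close> and each unimodular diagonal
  preserves them. Inner products are used in place of norms because distinct codes have to come out
  orthogonal.\<close>

lemma chain_isometry: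
  assumes "\<And>i u. i \<in> {1..n + 1} \<Longrightarrow> u < p \<Longrightarrow> norm (D i u) = 1"
    and "\<And>i. i \<in> {1..n} \<Longrightarrow> permutes_mod p (f i) \<and> permutes_mod p (f' i)"
  shows "(\<Sum>u<p. chain p (\<lambda>i. phase_kernel p (f i) (f' i)) D n c u *
        cnj (chain p (\<lambda>i. phase_kernel p (f i) (f' i)) D n c' u)) =
    of_nat (p ^ n) * (\<Sum>a<p. c a * cnj (c' a))"
  using assms
proof (induction n arbitrary: c c')
  case 0
  have "(D 1 u * c u) * cnj (D 1 u * c' u) = c u * cnj (c' u)" if "u < p" for u
    using cnj_unimodular[OF 0(1)[of 1 u]] that by simp
  thus ?case by (auto intro!: sum.cong simp del: complex_cnj_mult)
next
  case (Suc n)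
  let ?D = "D (Suc (Suc n))"
  have D: "(?D b * c b) * cnj (?D b * c' b) = c b * cnj (c' b)" if "b < p" for b
    using cnj_unimodular[OF Suc.prems(1)[of "Suc (Suc n)" b]] that by simp
  have good: "permutes_mod p (f (Suc n))" "permutes_mod p (f' (Suc n))"
    using Suc.prems(2)[of "Suc n"] by auto
  have "(\<Sum>b<p. (?D b * c b) * cnj (?D b * c' b)) = (\<Sum>b<p. c b * cnj (c' b))"
    using D by (intro sum.cong) auto
  moreover note Suc.IH[OF Suc.prems(1) Suc.prems(2)]
  ultimately show ?case
    by (simp add: kernel_isometry[OF good] del: complex_cnj_mult cnj_sum)
qed

text \<open>The factors are inverted one at a time: kernels by \<open>kernel_surjective\<close>,
  diagonals by division.\<close>

lemma chain_surjective:
  assumes "\<And>i u. i \<in> {1..n + 1} \<Longrightarrow> u < p \<Longrightarrow> norm (D i u) = 1"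
    and "\<And>i. i \<in> {1..n} \<Longrightarrow> permutes_mod p (f i) \<and> permutes_mod p (f' i)"
  shows "\<exists>c. \<forall>u<p. chain p (\<lambda>i. phase_kernel p (f i) (f' i)) D n c u = r u"
  using assms
proof (induction n)
  case 0
  have "D 1 u * (r u / D 1 u) = r u" if "u < p" for u
    using 0(1)[of 1 u] that by auto
  thus ?case by (auto intro!: exI[of _ "\<lambda>u. r u / D 1 u"])
next
  case (Suc n)
  then obtain c where c: "\<forall>u<p. chain p (\<lambda>i. phase_kernel p (f i) (f' i)) D n c u = r u" by auto
  have "permutes_mod p (f (Suc n))" "permutes_mod p (f' (Suc n))"
    using Suc.prems(2)[of "Suc n"] by auto
  from kernel_surjective[OF this] obtain e
    where e: "\<forall>a<p. (\<Sum>b<p. phase_kernel p (f (Suc n)) (f' (Suc n)) a b * e b) = c a" by blast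
  let ?D = "D (Suc (Suc n))"
  have D: "?D b * (e b / ?D b) = e b" if "b < p" for b
    using Suc.prems(1)[of "Suc (Suc n)" b] that by auto
  have "chain p (\<lambda>i. phase_kernel p (f i) (f' i)) D (Suc n) (\<lambda>b. e b / ?D b) u = r u" if u: "u < p" for u
  proof -
    have "chain p (\<lambda>i. phase_kernel p (f i) (f' i)) D (Suc n) (\<lambda>b. e b / ?D b) u =
        chain p (\<lambda>i. phase_kernel p (f i) (f' i)) D n c u"
      unfolding chain.simps using u D e by (intro chain_cong) auto
    thus ?thesis using c u by simp
  qed
  thus ?case by blast
qed

lemma chain_null_vector:
  assumes p: "p > 0"
    and "\<And>i u. i \<in> {1..n + 1} \<Longrightarrow> u < p \<Longrightarrow> norm (D i u) = 1"
    and "\<exists>i\<in>{1..n}. \<not> (permutes_mod p (f i) \<and> permutes_mod p (f' i))"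
  shows "\<exists>c. (\<exists>a<p. c a \<noteq> 0) \<and> (\<forall>u<p. chain p (\<lambda>i. phase_kernel p (f i) (f' i)) D n c u = 0)"
  using assms(2,3)
proof (induction n)
  case (Suc n)
  let ?K = "phase_kernel p (f (Suc n)) (f' (Suc n))" and ?D = "D (Suc (Suc n))"
  \<comment> \<open>Here \<open>e\<close> is a nonzero input of the last kernel and \<open>r\<close>
    its output, which the shorter chain annihilates. If the last kernel is singular,
    \<open>r = 0\<close>; otherwise \<open>r\<close> is a null vector of the shorter chain and
    \<open>e\<close> its preimage. Dividing \<open>e\<close> by the last diagonal then gives the
    witness.\<close>
  have "\<exists>e r. (\<exists>a<p. e a \<noteq> 0) \<and> (\<forall>a<p. (\<Sum>b<p. ?K a b * e b) = r a) \<and>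
      (\<forall>u<p. chain p (\<lambda>i. phase_kernel p (f i) (f' i)) D n r u = 0)"
  proof (cases "permutes_mod p (f (Suc n)) \<and> permutes_mod p (f' (Suc n))")
    case False
    show ?thesis
      by (rule exE[OF kernel_null_vector[OF p False]], intro exI[of _ "\<lambda>_. 0"] exI)
        (auto simp: chain_zero)
  next
    case True
    with Suc.prems(2) have "\<exists>i\<in>{1..n}. \<not> (permutes_mod p (f i) \<and> permutes_mod p (f' i))"
      by (metis atLeastAtMost_iff le_Suc_eq)
    with Suc obtain c where c: "\<exists>a<p. c a \<noteq> 0"
      "\<forall>u<p. chain p (\<lambda>i. phase_kernel p (f i) (f' i)) D n c u = 0" by auto
    obtain e where e: "\<forall>a<p. (\<Sum>b<p. ?K a b * e b) = c a"
      using kernel_surjective True by blast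
    \<comment> \<open>The preimage of a nonzero vector under a linear map is nonzero.\<close>
    have "\<exists>a<p. e a \<noteq> 0"
    proof (rule ccontr)
      assume "\<not> ?thesis"
      hence "\<forall>a<p. (\<Sum>b<p. ?K a b * e b) = 0" by (auto intro!: sum.neutral)
      thus False using e c by auto
    qed
    thus ?thesis using e c by blast
  qed
  then obtain e r where e: "\<exists>a<p. e a \<noteq> 0" "\<forall>a<p. (\<Sum>b<p. ?K a b * e b) = r a"
    "\<forall>u<p. chain p (\<lambda>i. phase_kernel p (f i) (f' i)) D n r u = 0" by blast
  have D0: "?D b \<noteq> 0" if "b < p" for b
    using Suc.prems(1)[of "Suc (Suc n)" b] that by auto
  have "chain p (\<lambda>i. phase_kernel p (f i) (f' i)) D (Suc n) (\<lambda>b. e b / ?D b) u = 0" if u: "u < p" for u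
  proof -
    have "chain p (\<lambda>i. phase_kernel p (f i) (f' i)) D (Suc n) (\<lambda>b. e b / ?D b) u =
        chain p (\<lambda>i. phase_kernel p (f i) (f' i)) D n r u"
      unfolding chain.simps using u D0 e(2) by (intro chain_cong) auto
    thus ?thesis using e(3) u by simp
  qed
  moreover have "\<exists>a<p. e a / ?D a \<noteq> 0" using e(1) D0 by auto
  ultimately show ?case by (intro exI[of _ "\<lambda>b. e b / ?D b"]) simp
qed simp

section \<open>Two coupled chains\<close>

text \<open>The coupling \<open>ph\<close> joins the last vertex of the first path to the first
  vertex of the second. For a fixed first path it is part of the initial weight of the second; the
  resulting sum is then a boundary vector for the first chain.\<close>

lemma sum_path_weight_coupled:
  "(\<Sum>x\<in>{1..n1 + 1} \<rightarrow>\<^sub>E {..<p1}. \<Sum>y\<in>{1..n2 + 1} \<rightarrow>\<^sub>E {..<p2}.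
      s1 (x 1) * s2 (y 1) * path_weight T1 D1 n1 x * path_weight T2 D2 n2 y *
      ph (x (n1 + 1)) (y 1) * C (x (n1 + 1)) (y (n2 + 1))) =
    (\<Sum>u<p1. s1 u * (\<Sum>v<p2. s2 v *
      chain p1 T1 D1 n1 (\<lambda>a. ph a v * chain p2 T2 D2 n2 (C a) v) u))"
  (is "?lhs = ?rhs")
proof -
  let ?P1 = "{1..n1 + 1} \<rightarrow>\<^sub>E {..<p1}" and ?P2 = "{1..n2 + 1} \<rightarrow>\<^sub>E {..<p2}"
  have "(\<Sum>y\<in>?P2. s1 (x 1) * s2 (y 1) * path_weight T1 D1 n1 x * path_weight T2 D2 n2 y *
      ph (x (n1 + 1)) (y 1) * C (x (n1 + 1)) (y (n2 + 1))) =
      (\<Sum>v<p2. s1 (x 1) * path_weight T1 D1 n1 x *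
        (s2 v * (ph (x (n1 + 1)) v * chain p2 T2 D2 n2 (C (x (n1 + 1))) v)))" for x
    using arg_cong[OF sum_path_weight[where s = "\<lambda>v. s2 v * ph (x (n1 + 1)) v" and n = n2 and p = p2
          and T = T2 and D = D2 and c = "C (x (n1 + 1))"], of "\<lambda>w. s1 (x 1) * path_weight T1 D1 n1 x * w"]
    by (simp only: sum_distrib_left mult_ac)
  hence "?lhs = (\<Sum>v<p2. s2 v * (\<Sum>x\<in>?P1. s1 (x 1) * path_weight T1 D1 n1 x *
      (ph (x (n1 + 1)) v * chain p2 T2 D2 n2 (C (x (n1 + 1))) v)))"
    by (simp only: sum_distrib_left mult_ac) (rule sum.swap)
  also have "\<dots> = (\<Sum>v<p2. s2 v * (\<Sum>u<p1. s1 u *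
      chain p1 T1 D1 n1 (\<lambda>a. ph a v * chain p2 T2 D2 n2 (C a) v) u))"
    by (subst sum_path_weight) (rule refl)
  also have "\<dots> = ?rhs"
    by (simp only: sum_distrib_left mult_ac) (rule sum.swap)
  finally show ?thesis .
qed

section \<open>Characters of the product of two cyclic groups\<close>

abbreviation dft :: "nat \<Rightarrow> nat \<Rightarrow> nat \<Rightarrow> complex" where
  "dft p \<equiv> phase_kernel p (\<lambda>u. u) (\<lambda>u. u)"

definition character :: "nat \<Rightarrow> nat \<Rightarrow> nat \<Rightarrow> nat \<Rightarrow> nat \<Rightarrow> nat \<Rightarrow> complex" where
  "character p1 p2 t1 t2 a b = dft p1 t1 a * dft p2 t2 b"

lemma character_orthogonal:
  assumes "t1 < p1" "t1' < p1" "t2 < p2" "t2' < p2"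
  shows "(\<Sum>a<p1. \<Sum>b<p2. character p1 p2 t1 t2 a b * cnj (character p1 p2 t1' t2' a b)) =
    (if t1 = t1' \<and> t2 = t2' then of_nat (p1 * p2) else 0)"
proof -
  have "(\<Sum>a<p1. \<Sum>b<p2. character p1 p2 t1 t2 a b * cnj (character p1 p2 t1' t2' a b)) =
      (\<Sum>a<p1. dft p1 a t1 * cnj (dft p1 a t1')) * (\<Sum>b<p2. dft p2 b t2 * cnj (dft p2 b t2'))"
    by (simp only: character_def sum_product complex_cnj_mult mult_ac
        kernel_transpose[of p1 _ _ t1] kernel_transpose[of p1 _ _ t1']
        kernel_transpose[of p2 _ _ t2] kernel_transpose[of p2 _ _ t2'])
  thus ?thesis using assms by (simp add: kernel_orthogonal)
qed

text \<open>Fourier inversion in two stages: in the second variable for each fixed \<open>a\<close>,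
  then in the first variable for each coefficient obtained.\<close>

lemma character_expansion:
  "\<exists>k. \<forall>a<p1. \<forall>b<p2.
    C a b = (\<Sum>(t1, t2)\<in>{..<p1} \<times> {..<p2}. k t1 t2 * character p1 p2 t1 t2 a b)"
proof -
  have "\<forall>a. \<exists>c. \<forall>b<p2. (\<Sum>t<p2. dft p2 b t * c t) = C a b"
    by (intro allI kernel_surjective) simp_all
  then obtain c where c: "\<And>a b. b < p2 \<Longrightarrow> (\<Sum>t<p2. dft p2 b t * c a t) = C a b" by metis
  have "\<forall>t. \<exists>k. \<forall>a<p1. (\<Sum>s<p1. dft p1 a s * k s) = c a t"
    by (intro allI kernel_surjective) simp_all
  then obtain k where k: "\<And>t a. a < p1 \<Longrightarrow> (\<Sum>s<p1. dft p1 a s * k t s) = c a t" by metis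
  have "C a b = (\<Sum>(t1, t2)\<in>{..<p1} \<times> {..<p2}. k t2 t1 * character p1 p2 t1 t2 a b)"
    if "a < p1" "b < p2" for a b
  proof -
    have "C a b = (\<Sum>t<p2. dft p2 b t * (\<Sum>s<p1. dft p1 a s * k t s))"
      using that by (simp add: c k)
    also have "\<dots> = (\<Sum>t<p2. \<Sum>s<p1. k t s * character p1 p2 s t a b)"
      by (simp add: sum_distrib_left character_def kernel_transpose[of _ _ _ a]
          kernel_transpose[of _ _ _ b] mult_ac)
    also have "\<dots> = (\<Sum>s<p1. \<Sum>t<p2. k t s * character p1 p2 s t a b)"
      by (rule sum.swap)
    finally show ?thesis by (simp add: sum.cartesian_product)
  qed
  thus ?thesis by (intro exI[of _ "\<lambda>t1 t2. k t2 t1"]) blast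
qed

text \<open>Unimodular diagonals and phases are what evaluation at a point of the unit circle
  provides. The functions inside the kernels remain arbitrary, since both directions of the
  equivalence are treated here.\<close>

locale coupled_chains =
  fixes p1 n1 p2 n2 :: nat
    and f f' h h' :: "nat \<Rightarrow> nat \<Rightarrow> nat"
    and D1 D2 ph :: "nat \<Rightarrow> nat \<Rightarrow> complex"
  assumes p1: "p1 > 0" and p2: "p2 > 0"
    and D1: "norm (D1 i u) = 1" and D2: "norm (D2 i u) = 1" and ph: "norm (ph u v) = 1"
begin

abbreviation "K1 \<equiv> chain p1 (\<lambda>i. phase_kernel p1 (f i) (f' i)) D1 n1"
abbreviation "K2 \<equiv> chain p2 (\<lambda>j. phase_kernel p2 (h j) (h' j)) D2 n2"

text \<open>The second chain acts first: after it, \<open>v\<close> is the first vertex of the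
  second path while \<open>a\<close> is still the last vertex of the first, which are the two
  arguments of the phase.\<close>

definition coupled :: "(nat \<Rightarrow> nat \<Rightarrow> complex) \<Rightarrow> nat \<Rightarrow> nat \<Rightarrow> complex" where
  "coupled C u v = K1 (\<lambda>a. ph a v * K2 (C a) v) u"

text \<open>Applied to the character of \<open>(t1, t2)\<close>, this will be the value of the
  generating polynomial of sequence \<open>(d1, d2)\<close> in the code
  \<open>(t1, t2)\<close>.\<close>

definition coupled_dft :: "(nat \<Rightarrow> nat \<Rightarrow> complex) \<Rightarrow> nat \<Rightarrow> nat \<Rightarrow> complex" where
  "coupled_dft C d1 d2 = (\<Sum>u<p1. dft p1 d1 u * (\<Sum>v<p2. dft p2 d2 v * coupled C u v))"

definition good1 :: bool where
  "good1 \<longleftrightarrow> (\<forall>i\<in>{1..n1}. permutes_mod p1 (f i) \<and> permutes_mod p1 (f' i))"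

definition good2 :: bool where
  "good2 \<longleftrightarrow> (\<forall>j\<in>{1..n2}. permutes_mod p2 (h j) \<and> permutes_mod p2 (h' j))"

lemma coupled_cong:
  assumes "\<And>a b. a < p1 \<Longrightarrow> b < p2 \<Longrightarrow> C a b = C' a b" "u < p1" "v < p2"
  shows "coupled C u v = coupled C' u v"
  unfolding coupled_def using assms
  by (intro chain_cong arg_cong2[where f = "(*)"]) auto

lemma coupled_dft_cong:
  assumes "\<And>a b. a < p1 \<Longrightarrow> b < p2 \<Longrightarrow> C a b = C' a b"
  shows "coupled_dft C d1 d2 = coupled_dft C' d1 d2"
proof -
  have "coupled C u v = coupled C' u v" if "u < p1" "v < p2" for u v
    using coupled_cong[OF assms that] .
  thus ?thesis by (simp add: coupled_dft_def)
qed

lemma coupled_sum: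
  "coupled (\<lambda>a b. \<Sum>t\<in>S. k t * c t a b) u v = (\<Sum>t\<in>S. k t * coupled (c t) u v)"
proof -
  have "coupled (\<lambda>a b. \<Sum>t\<in>S. k t * c t a b) u v =
      K1 (\<lambda>a. \<Sum>t\<in>S. k t * (ph a v * K2 (c t a) v)) u"
    by (simp add: coupled_def chain_sum[where k = k] sum_distrib_left mult_ac)
  thus ?thesis by (simp add: chain_sum coupled_def)
qed

lemma coupled_dft_sum:
  "coupled_dft (\<lambda>a b. \<Sum>t\<in>S. k t * c t a b) d1 d2 = (\<Sum>t\<in>S. k t * coupled_dft (c t) d1 d2)"
proof -
  have "(\<Sum>v<p2. dft p2 d2 v * coupled (\<lambda>a b. \<Sum>t\<in>S. k t * c t a b) u v) =
      (\<Sum>t\<in>S. k t * (\<Sum>v<p2. dft p2 d2 v * coupled (c t) u v))" for u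
    unfolding coupled_sum sum_distrib_left by (subst sum.swap) (simp add: mult_ac)
  thus ?thesis
    unfolding coupled_dft_def by (simp only: sum_distrib_left mult_ac) (rule sum.swap)
qed

text \<open>For fixed \<open>v\<close> the first chain is an isometry in \<open>a\<close> up to a
  factor; the phase then cancels pointwise at \<open>(a, v)\<close>, and for fixed \<open>a\<close>
  the second chain is such an isometry as well.\<close>

lemma coupled_isometry:
  assumes good1 good2
  shows "(\<Sum>u<p1. \<Sum>v<p2. coupled C u v * cnj (coupled C' u v)) =
    of_nat (p1 ^ n1 * p2 ^ n2) * (\<Sum>a<p1. \<Sum>b<p2. C a b * cnj (C' a b))"
proof -
  have "(\<Sum>u<p1. \<Sum>v<p2. coupled C u v * cnj (coupled C' u v)) =
      (\<Sum>v<p2. \<Sum>u<p1. coupled C u v * cnj (coupled C' u v))"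
    by (rule sum.swap)
  also have "\<dots> = (\<Sum>v<p2. of_nat (p1 ^ n1) *
      (\<Sum>a<p1. (ph a v * K2 (C a) v) * cnj (ph a v * K2 (C' a) v)))"
    unfolding coupled_def using assms(1) D1
    by (intro sum.cong refl chain_isometry) (auto simp: good1_def)
  also have "\<dots> = (\<Sum>v<p2. of_nat (p1 ^ n1) * (\<Sum>a<p1. K2 (C a) v * cnj (K2 (C' a) v)))"
  proof -
    have "(ph a v * x) * cnj (ph a v * y) = x * cnj y" for a v x y
    proof -
      have "(ph a v * x) * cnj (ph a v * y) = (ph a v * cnj (ph a v)) * (x * cnj y)"
        by (simp only: complex_cnj_mult mult_ac)
      thus ?thesis by (simp only: cnj_unimodular[OF ph] mult_1)
    qed
    thus ?thesis by (simp only:)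
  qed
  also have "\<dots> = of_nat (p1 ^ n1) * (\<Sum>a<p1. \<Sum>v<p2. K2 (C a) v * cnj (K2 (C' a) v))"
    unfolding sum_distrib_left by (rule sum.swap)
  also have "\<dots> = of_nat (p1 ^ n1) * (\<Sum>a<p1. of_nat (p2 ^ n2) * (\<Sum>b<p2. C a b * cnj (C' a b)))"
    using assms(2) D2
    by (intro arg_cong2[where f = "(*)"] sum.cong refl chain_isometry) (auto simp: good2_def)
  finally show ?thesis by (simp add: sum_distrib_left mult_ac)
qed

lemma coupled_dft_isometry:
  assumes good1 good2
  shows "(\<Sum>(d1, d2)\<in>{..<p1} \<times> {..<p2}. coupled_dft C d1 d2 * cnj (coupled_dft C' d1 d2)) =
    of_nat (p1 * p2 * (p1 ^ n1 * p2 ^ n2)) * (\<Sum>a<p1. \<Sum>b<p2. C a b * cnj (C' a b))"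
proof -
  have "(\<Sum>(d1, d2)\<in>{..<p1} \<times> {..<p2}. coupled_dft C d1 d2 * cnj (coupled_dft C' d1 d2)) =
      (\<Sum>d2<p2. \<Sum>d1<p1. coupled_dft C d1 d2 * cnj (coupled_dft C' d1 d2))"
    by (subst sum.swap) (simp add: sum.cartesian_product)
  also have "\<dots> = (\<Sum>d2<p2. of_nat p1 * (\<Sum>u<p1. (\<Sum>v<p2. dft p2 d2 v * coupled C u v) *
      cnj (\<Sum>v<p2. dft p2 d2 v * coupled C' u v)))"
    unfolding coupled_dft_def by (subst kernel_isometry) simp_all
  also have "\<dots> = of_nat p1 * (\<Sum>u<p1. \<Sum>d2<p2. (\<Sum>v<p2. dft p2 d2 v * coupled C u v) *
      cnj (\<Sum>v<p2. dft p2 d2 v * coupled C' u v))"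
    unfolding sum_distrib_left[symmetric] by (subst sum.swap) (rule refl)
  also have "\<dots> = of_nat p1 * (\<Sum>u<p1. of_nat p2 * (\<Sum>v<p2. coupled C u v * cnj (coupled C' u v)))"
    by (subst kernel_isometry) simp_all
  finally show ?thesis
    using coupled_isometry[OF assms, of C C'] by (simp add: sum_distrib_left[symmetric])
qed

text \<open>If the second chain is singular, its null vector taken for every \<open>a\<close> is
  annihilated before the phase enters. Otherwise the second chain is invertible and can be made to
  cancel the phase, which leaves a null vector of the first chain.\<close>

lemma coupled_null_vector:
  assumes "\<not> (good1 \<and> good2)"
  shows "\<exists>C. (\<exists>a<p1. \<exists>b<p2. C a b \<noteq> 0) \<and> (\<forall>u<p1. \<forall>v<p2. coupled C u v = 0)"
proof (cases good2)
  case False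
  then obtain c where c: "\<exists>b<p2. c b \<noteq> 0" "\<forall>v<p2. K2 c v = 0"
    using chain_null_vector[where p = p2 and n = n2 and D = D2 and f = h and f' = h'] p2 D2
    by (auto simp: good2_def)
  have "coupled (\<lambda>_. c) u v = 0" if "v < p2" for u v
    using c(2) that by (simp add: coupled_def chain_zero)
  thus ?thesis using c(1) p1 by (intro exI[of _ "\<lambda>_. c"]) auto
next
  case True
  with assms have "\<not> good1" by simp
  then obtain c where c: "\<exists>a<p1. c a \<noteq> 0" "\<forall>u<p1. K1 c u = 0"
    using chain_null_vector[where p = p1 and n = n1 and D = D1 and f = f and f' = f'] p1 D1
    by (auto simp: good1_def)
  \<comment> \<open>The target is chosen so that multiplication by \<open>ph a v\<close> yields
    \<open>c a\<close> for every \<open>v\<close>.\<close>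
  have "\<exists>e. \<forall>v<p2. K2 e v = c a / ph a v" for a
    using True D2 by (intro chain_surjective) (auto simp: good2_def)
  then obtain C where C: "\<And>a v. v < p2 \<Longrightarrow> K2 (C a) v = c a / ph a v" by metis
  have ph0: "ph a v \<noteq> 0" for a v using ph[of a v] by auto
  have "coupled C u v = 0" if "u < p1" "v < p2" for u v
    using c(2) that ph0 by (simp add: coupled_def C)
  moreover have "\<exists>a<p1. \<exists>b<p2. C a b \<noteq> 0"
  proof (rule ccontr)
    assume "\<not> ?thesis"
    \<comment> \<open>If \<open>C\<close> vanished, its image \<open>c a / ph a v\<close> at
      \<open>v = 0\<close> would vanish for all \<open>a\<close>, against the choice of
      \<open>c\<close>.\<close>
    hence "K2 (C a) 0 = K2 (\<lambda>_. 0) 0" if "a < p1" for a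
      using that p2 by (intro chain_cong) auto
    hence "c a = 0" if "a < p1" for a
      using that C[of 0 a] p2 ph0 by (simp add: chain_zero)
    thus False using c(1) by blast
  qed
  ultimately show ?thesis by blast
qed

text \<open>Orthogonal columns of nonzero norm are linearly independent. A null vector, expanded in
  characters, would be a nontrivial relation between them.\<close>

lemma good_if_orthogonal:
  assumes "N \<noteq> 0"
    and orth: "\<And>t1 t2 t1' t2'. t1 < p1 \<Longrightarrow> t1' < p1 \<Longrightarrow> t2 < p2 \<Longrightarrow> t2' < p2 \<Longrightarrow>
      (\<Sum>(d1, d2)\<in>{..<p1} \<times> {..<p2}. coupled_dft (character p1 p2 t1 t2) d1 d2 *
        cnj (coupled_dft (character p1 p2 t1' t2') d1 d2)) =
      (if t1 = t1' \<and> t2 = t2' then N else 0)"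
  shows "good1 \<and> good2"
proof (rule ccontr)
  assume "\<not> ?thesis"
  then obtain C where C: "\<exists>a<p1. \<exists>b<p2. C a b \<noteq> 0" "\<forall>u<p1. \<forall>v<p2. coupled C u v = 0"
    using coupled_null_vector by blast
  let ?T = "{..<p1} \<times> {..<p2}" and ?\<chi> = "\<lambda>t. character p1 p2 (fst t) (snd t)"
  obtain k where "\<forall>a<p1. \<forall>b<p2. C a b = (\<Sum>(t1, t2)\<in>?T. k t1 t2 * character p1 p2 t1 t2 a b)"
    using character_expansion by blast
  hence k: "C a b = (\<Sum>t\<in>?T. k (fst t) (snd t) * ?\<chi> t a b)" if "a < p1" "b < p2" for a b
    using that by (simp add: case_prod_unfold)
  have zero: "(\<Sum>t\<in>?T. k (fst t) (snd t) * coupled_dft (?\<chi> t) d1 d2) = 0" for d1 d2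
  proof -
    have "(\<Sum>t\<in>?T. k (fst t) (snd t) * coupled_dft (?\<chi> t) d1 d2) = coupled_dft C d1 d2"
      unfolding coupled_dft_sum[symmetric] by (rule coupled_dft_cong) (simp only: k)
    also have "\<dots> = 0" using C(2) by (simp add: coupled_dft_def)
    finally show ?thesis .
  qed
  have "k (fst s) (snd s) = 0" if s: "s \<in> ?T" for s
  proof -
    \<comment> \<open>Pairing the vanishing combination with column \<open>s\<close> isolates the
      coefficient at \<open>s\<close>.\<close>
    have "0 = (\<Sum>d\<in>?T. (\<Sum>t\<in>?T. k (fst t) (snd t) * coupled_dft (?\<chi> t) (fst d) (snd d)) *
        cnj (coupled_dft (?\<chi> s) (fst d) (snd d)))"
      by (simp only: zero) simp
    also have "\<dots> = (\<Sum>t\<in>?T. k (fst t) (snd t) * (\<Sum>d\<in>?T. coupled_dft (?\<chi> t) (fst d) (snd d) *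
        cnj (coupled_dft (?\<chi> s) (fst d) (snd d))))"
      unfolding sum_distrib_left sum_distrib_right by (subst sum.swap) (simp only: mult.assoc)
    also have "\<dots> = (\<Sum>t\<in>?T. if t = s then k (fst t) (snd t) * N else 0)"
      using s orth by (intro sum.cong refl) (auto simp: case_prod_unfold prod_eq_iff)
    also have "\<dots> = k (fst s) (snd s) * N" using s by simp
    finally show ?thesis using \<open>N \<noteq> 0\<close> by simp
  qed
  hence "C a b = 0" if "a < p1" "b < p2" for a b using that by (simp add: k)
  thus False using C(1) by blast
qed

end

section \<open>Reindexing the mixed-radix tuples\<close>

lemma gen_poly_psi:
  "gen_poly (psi q p1 m1 p2 m2 F) z =
    (\<Sum>x\<in>mixed_tuples p1 m1 p2 m2. xi q ^ F x * z ^ tuple_index p1 m1 p2 m2 x)"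
proof -
  let ?ix = "tuple_index p1 m1 p2 m2" and ?tp = "tuple_of p1 m1 p2 m2"
  have tp: "?tp (?ix x) = x" if "x \<in> mixed_tuples p1 m1 p2 m2" for x
  proof -
    have "?ix x < p1 ^ m1 * p2 ^ m2"
      using bij_betw_tuple_index[of p1 m1 p2 m2] that by (auto simp: bij_betw_def)
    from ex1_tuple[OF this] show ?thesis
      unfolding tuple_of_def using that by (intro the1_equality) auto
  qed
  have "gen_poly (psi q p1 m1 p2 m2 F) z = (\<Sum>n<p1 ^ m1 * p2 ^ m2. xi q ^ F (?tp n) * z ^ n)"
    by (simp add: gen_poly_def psi_def)
  also have "\<dots> = (\<Sum>x\<in>mixed_tuples p1 m1 p2 m2. xi q ^ F (?tp (?ix x)) * z ^ ?ix x)"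
    by (rule sum.reindex_bij_betw[OF bij_betw_tuple_index, symmetric])
  also have "\<dots> = (\<Sum>x\<in>mixed_tuples p1 m1 p2 m2. xi q ^ F x * z ^ ?ix x)"
    by (intro sum.cong refl) (simp add: tp)
  finally show ?thesis .
qed

text \<open>The tuple is split into two paths, read in the orders \<open>\<pi>\<close> and
  \<open>\<rho>\<close>. Since these orders reach every coordinate, the splitting is injective, and
  equal cardinalities make it bijective.\<close>

lemma sum_mixed_tuples_permuted:
  assumes \<pi>: "\<pi> \<in> {1..m1} \<rightarrow> {1..m1}" "inj_on \<pi> {1..m1}"
    and \<rho>: "\<rho> \<in> {1..m2} \<rightarrow> {1..m2}" "inj_on \<rho> {1..m2}"
    and H: "\<And>x. x \<in> mixed_tuples p1 m1 p2 m2 \<Longrightarrow>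
      F x = H (\<lambda>i\<in>{1..m1}. x (\<pi> i)) (\<lambda>j\<in>{1..m2}. x (m1 + \<rho> j))"
  shows "(\<Sum>x\<in>mixed_tuples p1 m1 p2 m2. F x) =
    (\<Sum>x\<in>{1..m1} \<rightarrow>\<^sub>E {..<p1}. \<Sum>y\<in>{1..m2} \<rightarrow>\<^sub>E {..<p2}. H x y)"
proof -
  let ?M = "mixed_tuples p1 m1 p2 m2"
  let ?P = "({1..m1} \<rightarrow>\<^sub>E {..<p1}) \<times> ({1..m2} \<rightarrow>\<^sub>E {..<p2})"
  define \<Phi> where "\<Phi> = (\<lambda>x. (\<lambda>i\<in>{1..m1}. x (\<pi> i) :: nat, \<lambda>j\<in>{1..m2}. x (m1 + \<rho> j) :: nat))"
  have surj: "\<pi> ` {1..m1} = {1..m1}" "\<rho> ` {1..m2} = {1..m2}"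
    using \<pi> \<rho> by (simp_all add: endo_inj_surj image_subset_iff_funcset)
  have M: "x j < p1" if "x \<in> ?M" "j \<in> {1..m1}" for x j
    using PiE_mem[OF that(1)[unfolded mixed_tuples_def], of j] that(2) by simp
  have M': "x (m1 + j) < p2" if "x \<in> ?M" "j \<in> {1..m2}" for x j
    using PiE_mem[OF that(1)[unfolded mixed_tuples_def], of "m1 + j"] that(2) by simp
  have sub: "\<Phi> ` ?M \<subseteq> ?P"
    using M M' \<pi>(1) \<rho>(1) by (auto simp: \<Phi>_def Pi_iff)
  have inj: "inj_on \<Phi> ?M"
  proof (rule inj_onI)
    fix x y assume xy: "x \<in> ?M" "y \<in> ?M" "\<Phi> x = \<Phi> y"
    have 1: "x (\<pi> i) = y (\<pi> i)" if "i \<in> {1..m1}" for i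
      using fun_cong[OF arg_cong[OF xy(3), of fst], of i] that by (simp add: \<Phi>_def)
    have 2: "x (m1 + \<rho> j) = y (m1 + \<rho> j)" if "j \<in> {1..m2}" for j
      using fun_cong[OF arg_cong[OF xy(3), of snd], of j] that by (simp add: \<Phi>_def)
    have "x k = y k" if "k \<in> {1..m1+m2}" for k
    proof (cases "k \<le> m1")
      case True
      hence "k \<in> \<pi> ` {1..m1}" using that surj by simp
      thus ?thesis using 1 by blast
    next
      case False
      hence "k - m1 \<in> \<rho> ` {1..m2}" using that surj by auto
      then obtain j where "j \<in> {1..m2}" "k - m1 = \<rho> j" by blast
      moreover have "m1 + (k - m1) = k" using False by simp
      ultimately show ?thesis using 2 by metis
    qed
    thus "x = y"
      using xy(1,2) unfolding mixed_tuples_def by (intro PiE_ext[of x _ _ y]) auto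
  qed
  have "card ?M = p1 ^ m1 * p2 ^ m2"
    using bij_betw_same_card[OF bij_betw_tuple_index] by simp
  hence "card (\<Phi> ` ?M) = card ?P"
    by (simp add: card_image[OF inj] card_cartesian_product card_PiE)
  hence "\<Phi> ` ?M = ?P"
    using sub by (intro card_subset_eq) (auto intro!: finite_PiE)
  hence "bij_betw \<Phi> ?M ?P" using inj by (simp add: bij_betw_def)
  from sum.reindex_bij_betw[OF this, of "\<lambda>(x, y). H x y"]
  have "(\<Sum>x\<in>?M. F x) = (\<Sum>(x, y)\<in>?P. H x y)"
    using H by (simp add: \<Phi>_def)
  thus ?thesis by (simp add: sum.cartesian_product)
qed

section \<open>The code sequences as coupled chains\<close>

lemma code_corr_map:
  assumes "distinct ds"
  shows "code_corr (map F ds) (map G ds) \<tau> = (\<Sum>d\<in>set ds. aperiodic_corr (F d) (G d) \<tau>)"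
proof -
  have "code_corr (map F ds) (map G ds) \<tau> = (\<Sum>l<length ds. aperiodic_corr (F (ds ! l)) (G (ds ! l)) \<tau>)"
    by (simp add: code_corr_def)
  also have "\<dots> = (\<Sum>d\<in>set ds. aperiodic_corr (F d) (G d) \<tau>)"
    using sum.reindex_bij_betw[OF bij_betw_nth[OF assms refl refl],
        of "\<lambda>d. aperiodic_corr (F d) (G d) \<tau>"] by simp
  finally show ?thesis .
qed

text \<open>Vertex weights are attached to variables, so reindexing by \<open>\<sigma>\<close>
  removes the permutation from their product; it remains only in the edges. The numbers
  \<open>e k\<close> stand for the place values of the digits.\<close>

lemma path_weight_kernel:
  assumes \<sigma>: "\<sigma> \<in> {1..n + 1} \<rightarrow> {1..n + 1}" "inj_on \<sigma> {1..n + 1}"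
  shows "path_weight (\<lambda>i. phase_kernel p (f i) (f' i)) (\<lambda>i u. w ^ g (\<sigma> i) u * z ^ (u * e (\<sigma> i))) n
      (\<lambda>i\<in>{1..n + 1}. x (\<sigma> i)) =
    xi p ^ (\<Sum>i=1..n. f i (x (\<sigma> i)) * f' i (x (\<sigma> (i + 1)))) *
    (w ^ (\<Sum>k=1..n + 1. g k (x k)) * z ^ (\<Sum>k=1..n + 1. x k * e k))"
proof -
  let ?X = "\<lambda>i\<in>{1..n + 1}. x (\<sigma> i)"
  have bij: "bij_betw \<sigma> {1..n + 1} {1..n + 1}"
    using \<sigma> endo_inj_surj[of "{1..n + 1}" \<sigma>] by (simp add: bij_betw_def image_subset_iff_funcset)
  have "(\<Prod>i=1..n. phase_kernel p (f i) (f' i) (?X i) (?X (i + 1))) =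
      (\<Prod>i=1..n. xi p ^ (f i (x (\<sigma> i)) * f' i (x (\<sigma> (i + 1)))))"
    by (intro prod.cong refl) (simp add: phase_kernel_def)
  moreover have "(\<Prod>i=1..n + 1. w ^ g (\<sigma> i) (?X i) * z ^ (?X i * e (\<sigma> i))) =
      (\<Prod>i=1..n + 1. w ^ g (\<sigma> i) (x (\<sigma> i)) * z ^ (x (\<sigma> i) * e (\<sigma> i)))"
    by (intro prod.cong refl) simp
  moreover have "\<dots> = (\<Prod>k=1..n + 1. w ^ g k (x k) * z ^ (x k * e k))"
    by (rule prod.reindex_bij_betw[OF bij])
  ultimately show ?thesis
    by (simp only: path_weight_def power_sum prod.distrib)
qed

text \<open>Each term of the exponent finds its place: product terms are edges, \<open>g\<close>,
  \<open>g'\<close> and the digits of the index are vertex weights, the term with \<open>lam\<close>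
  is the coupling, \<open>d1\<close> and \<open>d2\<close> give Fourier factors at the initial
  vertices, and \<open>t1\<close> and \<open>t2\<close> give a character at the final
  vertices.\<close>

lemma gen_poly_sequence:
  fixes g g' :: "nat \<Rightarrow> nat \<Rightarrow> nat"
  assumes q: "q = p1 * p2" "p1 > 0" "p2 > 0" and m: "m1 = n1 + 1" "m2 = n2 + 1"
    and \<pi>: "\<pi> \<in> {1..m1} \<rightarrow> {1..m1}" "inj_on \<pi> {1..m1}"
    and \<rho>: "\<rho> \<in> {1..m2} \<rightarrow> {1..m2}" "inj_on \<rho> {1..m2}"
    and F: "\<And>x. x \<in> mixed_tuples p1 m1 p2 m2 \<Longrightarrow> F x =
      ((q div p1) * (\<Sum>i=1..n1. f i (x (\<pi> i)) * f' i (x (\<pi> (i + 1))))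
       + (\<Sum>\<alpha>=1..m1. g \<alpha> (x \<alpha>))
       + (q div p2) * (\<Sum>j=1..n2. h j (x (m1 + \<rho> j)) * h' j (x (m1 + \<rho> (j + 1))))
       + (\<Sum>\<beta>=1..m2. g' \<beta> (x (\<beta> + m1)))
       + lam * f0 (x (\<pi> m1)) * h0 (x (m1 + \<rho> 1))) mod q"
  shows "gen_poly (psi q p1 m1 p2 m2 (\<lambda>x. (F x + (q div p1) * (d1 * x (\<pi> 1) + t1 * x (\<pi> m1))
        + (q div p2) * (d2 * x (m1 + \<rho> 1) + t2 * x (m1 + \<rho> m2))) mod q)) z =
    (\<Sum>u<p1. dft p1 d1 u * (\<Sum>v<p2. dft p2 d2 v *
      chain p1 (\<lambda>i. phase_kernel p1 (f i) (f' i)) (\<lambda>i u. xi q ^ g (\<pi> i) u * z ^ (u * p1 ^ (\<pi> i - 1))) n1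
        (\<lambda>a. xi q ^ (lam * f0 a * h0 v) *
          chain p2 (\<lambda>j. phase_kernel p2 (h j) (h' j))
            (\<lambda>j v. xi q ^ g' (\<rho> j) v * z ^ (v * (p1 ^ m1 * p2 ^ (\<rho> j - 1)))) n2
            (character p1 p2 t1 t2 a) v) u))"
proof -
  let ?D1 = "\<lambda>i u. xi q ^ g (\<pi> i) u * z ^ (u * p1 ^ (\<pi> i - 1))"
  let ?D2 = "\<lambda>j v. xi q ^ g' (\<rho> j) v * z ^ (v * (p1 ^ m1 * p2 ^ (\<rho> j - 1)))"
  let ?T1 = "\<lambda>i. phase_kernel p1 (f i) (f' i)" and ?T2 = "\<lambda>j. phase_kernel p2 (h j) (h' j)"
  let ?ph = "\<lambda>a v. xi q ^ (lam * f0 a * h0 v)"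
  have q0: "q > 0" and xi: "xi q ^ (q div p1) = xi p1" "xi q ^ (q div p2) = xi p2"
    using q by (simp, (intro xi_power_div; simp)+)
  define H where "H = (\<lambda>x y. dft p1 d1 (x 1) * dft p2 d2 (y 1) * path_weight ?T1 ?D1 n1 x *
    path_weight ?T2 ?D2 n2 y * ?ph (x (n1 + 1)) (y 1) *
    character p1 p2 t1 t2 (x (n1 + 1)) (y (n2 + 1)))"
  have "xi q ^ ((F x + (q div p1) * (d1 * x (\<pi> 1) + t1 * x (\<pi> m1))
        + (q div p2) * (d2 * x (m1 + \<rho> 1) + t2 * x (m1 + \<rho> m2))) mod q) *
      z ^ tuple_index p1 m1 p2 m2 x =
      H (\<lambda>i\<in>{1..m1}. x (\<pi> i)) (\<lambda>j\<in>{1..m2}. x (m1 + \<rho> j))"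
    if x: "x \<in> mixed_tuples p1 m1 p2 m2" for x
  proof -
    let ?S1 = "\<Sum>i=1..n1. f i (x (\<pi> i)) * f' i (x (\<pi> (i + 1)))"
    let ?S2 = "\<Sum>j=1..n2. h j (x (m1 + \<rho> j)) * h' j (x (m1 + \<rho> (j + 1)))"
    let ?G1 = "\<Sum>\<alpha>=1..m1. g \<alpha> (x \<alpha>)" and ?G2 = "\<Sum>\<beta>=1..m2. g' \<beta> (x (m1 + \<beta>))"
    let ?I1 = "\<Sum>j=1..m1. x j * p1 ^ (j - 1)"
    let ?I2 = "\<Sum>j=1..m2. x (m1 + j) * (p1 ^ m1 * p2 ^ (j - 1))"
    have w1: "path_weight ?T1 ?D1 n1 (\<lambda>i\<in>{1..m1}. x (\<pi> i)) = xi p1 ^ ?S1 * (xi q ^ ?G1 * z ^ ?I1)"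
      unfolding m(1) by (rule path_weight_kernel) (use \<pi> m in auto)
    have w2: "path_weight ?T2 ?D2 n2 (\<lambda>j\<in>{1..m2}. x (m1 + \<rho> j)) =
        xi p2 ^ ?S2 * (xi q ^ ?G2 * z ^ ?I2)"
      unfolding m(2) by (rule path_weight_kernel[where x = "\<lambda>j. x (m1 + j)"]) (use \<rho> m in auto)
    have ix: "tuple_index p1 m1 p2 m2 x = ?I1 + ?I2"
      by (simp add: tuple_index_def sum_distrib_left mult_ac)
    \<comment> \<open>Reduction modulo \<open>q\<close> does not affect powers of
      \<open>xi q\<close>, and the coefficients \<open>q div p1\<close> and \<open>q div p2\<close>
      turn it into \<open>xi p1\<close> and \<open>xi p2\<close>.\<close>
    have "xi q ^ F x = xi p1 ^ ?S1 * xi q ^ ?G1 * xi p2 ^ ?S2 * xi q ^ ?G2 * ?ph (x (\<pi> m1)) (x (m1 + \<rho> 1))"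
      unfolding F[OF x] xi_power_mod[OF q0] power_add power_mult[of _ "q div _"] xi
      by (simp only: add.commute[of _ m1])
    hence "xi q ^ ((F x + (q div p1) * (d1 * x (\<pi> 1) + t1 * x (\<pi> m1))
        + (q div p2) * (d2 * x (m1 + \<rho> 1) + t2 * x (m1 + \<rho> m2))) mod q) =
        xi p1 ^ ?S1 * xi q ^ ?G1 * xi p2 ^ ?S2 * xi q ^ ?G2 * ?ph (x (\<pi> m1)) (x (m1 + \<rho> 1)) *
        (xi p1 ^ (d1 * x (\<pi> 1)) * xi p1 ^ (t1 * x (\<pi> m1))) *
        (xi p2 ^ (d2 * x (m1 + \<rho> 1)) * xi p2 ^ (t2 * x (m1 + \<rho> m2)))"
      unfolding xi_power_mod[OF q0] by (simp only: power_add power_mult[of _ "q div _"] xi)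
    thus ?thesis
      unfolding H_def w1 w2 ix power_add
      by (simp add: m phase_kernel_def character_def mult_ac del: sum.cl_ivl_Suc)
  qed
  hence "(\<Sum>x\<in>mixed_tuples p1 m1 p2 m2. xi q ^ ((F x + (q div p1) * (d1 * x (\<pi> 1) + t1 * x (\<pi> m1))
        + (q div p2) * (d2 * x (m1 + \<rho> 1) + t2 * x (m1 + \<rho> m2))) mod q) *
      z ^ tuple_index p1 m1 p2 m2 x) =
      (\<Sum>x\<in>{1..m1} \<rightarrow>\<^sub>E {..<p1}. \<Sum>y\<in>{1..m2} \<rightarrow>\<^sub>E {..<p2}. H x y)"
    by (rule sum_mixed_tuples_permuted[OF \<pi> \<rho>])
  thus ?thesis
    unfolding gen_poly_psi H_def m
      sum_path_weight_coupled[where ?s1.0 = "dft p1 d1" and ?s2.0 = "dft p2 d2" and ph = ?ph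
        and C = "character p1 p2 t1 t2"] .
qed

section \<open>Complementarity and the permutation conditions\<close>

theorem theorem2:
  fixes p1 p2 q m1 m2 m L lam :: nat
    and ff ff' hh hh' g g' :: "nat \<Rightarrow> nat \<Rightarrow> nat"
    and f0 h0 \<pi> \<pi>' :: "nat \<Rightarrow> nat"
    and f :: "(nat \<Rightarrow> nat) \<Rightarrow> nat"
  assumes "prime p1" and "prime p2" and "p1 < p2" and "q = p1 * p2"
    and "m1 > 0" and "m2 > 0" and "m = m1 + m2" and "L = p1 ^ m1 * p2 ^ m2"
    and "\<forall>i\<in>{1..m1 - 1}. ff i \<in> {0..<q} \<rightarrow> {0..<q} \<and> ff' i \<in> {0..<q} \<rightarrow> {0..<q}"
    and "\<forall>j\<in>{1..m2 - 1}. hh j \<in> {0..<q} \<rightarrow> {0..<q} \<and> hh' j \<in> {0..<q} \<rightarrow> {0..<q}"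
    and "f0 \<in> {0..<q} \<rightarrow> {0..<q}" and "h0 \<in> {0..<q} \<rightarrow> {0..<q}"
    and "\<forall>\<alpha>\<in>{1..m1}. g \<alpha> \<in> {0..<q} \<rightarrow> {0..<q}"
    and "\<forall>\<beta>\<in>{1..m2}. g' \<beta> \<in> {0..<q} \<rightarrow> {0..<q}"
    and "\<pi> \<in> {1..m1} \<rightarrow> {1..m1}" and "inj_on \<pi> {1..m1}"
    and "\<pi>' \<in> {m1 + 1..m} \<rightarrow> {m1 + 1..m}" and "inj_on \<pi>' {m1 + 1..m}"
    and "lam \<in> {0..<q}"
    and "\<forall>x\<in>mixed_tuples p1 m1 p2 m2. f x =
           ((q div p1) * (\<Sum>i=1..m1 - 1. ff i (x (\<pi> i)) * ff' i (x (\<pi> (i + 1))))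
            + (\<Sum>\<alpha>=1..m1. g \<alpha> (x \<alpha>))
            + (q div p2) * (\<Sum>j=1..m2 - 1. hh j (x (\<pi>' (m1 + j))) * hh' j (x (\<pi>' (m1 + j + 1))))
            + (\<Sum>\<beta>=1..m2. g' \<beta> (x (\<beta> + m1)))
            + lam * f0 (x (\<pi> m1)) * h0 (x (\<pi>' (m1 + 1)))) mod q"
  shows "is_CCC (p1 * p2) L
           (map (\<lambda>t. code_of q p1 m1 p2 m2 f \<pi> \<pi>' (t mod p1) (t div p1)) [0..<p1 * p2])
         \<longleftrightarrow>
         (\<forall>i\<in>{1..m1 - 1}. permutes_mod p1 (ff i) \<and> permutes_mod p1 (ff' i)) \<and>
         (\<forall>j\<in>{1..m2 - 1}. permutes_mod p2 (hh j) \<and> permutes_mod p2 (hh' j))"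
proof -
  \<comment> \<open>A path with \<open>m1\<close> or \<open>m2\<close> vertices has one edge
    fewer.\<close>
  define n1 n2 where "n1 = m1 - 1" and "n2 = m2 - 1"
  have m: "m1 = n1 + 1" "m2 = n2 + 1" using assms(5,6) by (simp_all add: n1_def n2_def)
  have p: "p1 > 0" "p2 > 0" using assms(1,2) by (simp_all add: prime_gt_0_nat)
  have L: "L > 0" "L = p1 * p2 * (p1 ^ n1 * p2 ^ n2)" using p by (simp_all add: assms(8) m)
  \<comment> \<open>The second permutation is shifted so that the vertices of both paths are
    numbered from 1.\<close>
  define \<rho> where "\<rho> = (\<lambda>j. \<pi>' (m1 + j) - m1)"
  have \<pi>': "\<pi>' (m1 + j) = m1 + \<rho> j" "\<rho> j \<in> {1..m2}" if "j \<in> {1..m2}" for j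
  proof -
    have "\<pi>' (m1 + j) \<in> {m1 + 1..m}" using assms(17) that by (auto simp: assms(7) Pi_iff)
    thus "\<pi>' (m1 + j) = m1 + \<rho> j" "\<rho> j \<in> {1..m2}" by (auto simp: \<rho>_def assms(7))
  qed
  have \<rho>: "\<rho> \<in> {1..m2} \<rightarrow> {1..m2}" using \<pi>'(2) by blast
  have \<rho>_inj: "inj_on \<rho> {1..m2}"
  proof (rule inj_onI)
    fix i j assume ij: "i \<in> {1..m2}" "j \<in> {1..m2}" "\<rho> i = \<rho> j"
    hence "\<pi>' (m1 + i) = \<pi>' (m1 + j)" by (simp add: \<pi>'(1))
    with ij show "i = j" using inj_onD[OF assms(18), of "m1 + i" "m1 + j"] by (simp add: assms(7))
  qed
  have f: "f x = ((q div p1) * (\<Sum>i=1..n1. ff i (x (\<pi> i)) * ff' i (x (\<pi> (i + 1))))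
       + (\<Sum>\<alpha>=1..m1. g \<alpha> (x \<alpha>))
       + (q div p2) * (\<Sum>j=1..n2. hh j (x (m1 + \<rho> j)) * hh' j (x (m1 + \<rho> (j + 1))))
       + (\<Sum>\<beta>=1..m2. g' \<beta> (x (\<beta> + m1)))
       + lam * f0 (x (\<pi> m1)) * h0 (x (m1 + \<rho> 1))) mod q"
    if "x \<in> mixed_tuples p1 m1 p2 m2" for x
  proof -
    have "(\<Sum>j=1..m2 - 1. hh j (x (\<pi>' (m1 + j))) * hh' j (x (\<pi>' (m1 + j + 1)))) =
        (\<Sum>j=1..n2. hh j (x (m1 + \<rho> j)) * hh' j (x (m1 + \<rho> (j + 1))))"
    proof (rule sum.cong)
      fix j assume "j \<in> {1..n2}"
      hence "j \<in> {1..m2}" "j + 1 \<in> {1..m2}" by (auto simp: m)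
      thus "hh j (x (\<pi>' (m1 + j))) * hh' j (x (\<pi>' (m1 + j + 1))) =
          hh j (x (m1 + \<rho> j)) * hh' j (x (m1 + \<rho> (j + 1)))"
        by (simp only: \<pi>'(1) add.assoc)
    qed (simp add: n2_def)
    moreover have "\<pi>' (m1 + 1) = m1 + \<rho> 1" by (rule \<pi>'(1)) (simp add: m)
    ultimately show ?thesis using assms(20) that by (simp only: n1_def)
  qed
  define s where "s = (\<lambda>k (d1, d2). psi q p1 m1 p2 m2
    (\<lambda>x. (f x + (q div p1) * (d1 * x (\<pi> 1) + k mod p1 * x (\<pi> m1))
       + (q div p2) * (d2 * x (m1 + \<rho> 1) + k div p1 * x (m1 + \<rho> m2))) mod q))"
  define D1 where "D1 = (\<lambda>z i u. xi q ^ g (\<pi> i) u * z ^ (u * p1 ^ (\<pi> i - 1)))"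
  define D2 where "D2 = (\<lambda>z j v. xi q ^ g' (\<rho> j) v * z ^ (v * (p1 ^ m1 * p2 ^ (\<rho> j - 1))))"
  define ph where "ph = (\<lambda>a v. xi q ^ (lam * f0 a * h0 v))"
  let ?S = "\<lambda>z. coupled_chains.coupled_dft p1 n1 p2 n2 ff ff' hh hh' (D1 z) (D2 z) ph"
  let ?\<chi> = "\<lambda>k. character p1 p2 (k mod p1) (k div p1)"
  let ?X = "{..<p1} \<times> {..<p2}"
  have cc: "coupled_chains p1 p2 (D1 z) (D2 z) ph" if "norm z = 1" for z
    using that p by unfold_locales (simp_all add: D1_def D2_def ph_def norm_mult norm_power)
  have len: "length (s k d) = L" for k d
    by (cases d) (simp add: s_def psi_def assms(8))
  have gp: "gen_poly (s k d) z = ?S z (?\<chi> k) (fst d) (snd d)" if "norm z = 1" for k d z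
    unfolding coupled_chains.coupled_dft_def[OF cc[OF that]] coupled_chains.coupled_def[OF cc[OF that]]
    unfolding D1_def D2_def ph_def s_def case_prod_unfold
    by (rule gen_poly_sequence[OF assms(4) p m assms(15,16) \<rho> \<rho>_inj f])
  have code: "code_of q p1 m1 p2 m2 f \<pi> \<pi>' (k mod p1) (k div p1) =
      map (s k) (List.product [0..<p1] [0..<p2])" for k
    using \<pi>'(1)[of 1] \<pi>'(1)[of m2] by (simp add: code_of_def s_def m)
  have X: "set (List.product [0..<p1] [0..<p2]) = ?X" by auto
  \<comment> \<open>The counts and lengths hold by construction, so only the correlation conditions
    remain.\<close>
  have CCC: "is_CCC (p1 * p2) L
        (map (\<lambda>t. code_of q p1 m1 p2 m2 f \<pi> \<pi>' (t mod p1) (t div p1)) [0..<p1 * p2]) \<longleftrightarrow>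
      (\<forall>k<p1 * p2. \<forall>l<p1 * p2. \<forall>\<tau>. \<bar>\<tau>\<bar> < int L \<longrightarrow>
        (\<Sum>d\<in>?X. aperiodic_corr (s k d) (s l d) \<tau>) =
        (if \<tau> = 0 \<and> k = l then of_nat (p1 * p2 * L) else 0))"
    by (auto simp: is_CCC_def code code_corr_map distinct_product X len simp del: set_product)
  have eq_iff: "k = l \<longleftrightarrow> k mod p1 = l mod p1 \<and> k div p1 = l div p1" for k l
    by (metis div_mult_mod_eq)
  have index_bounds: "k mod p1 < p1" "k div p1 < p2" if "k < p1 * p2" for k
    using that p by (simp_all add: less_mult_imp_div_less mult.commute)
  have good: "(\<forall>i\<in>{1..m1 - 1}. permutes_mod p1 (ff i) \<and> permutes_mod p1 (ff' i)) \<and>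
      (\<forall>j\<in>{1..m2 - 1}. permutes_mod p2 (hh j) \<and> permutes_mod p2 (hh' j)) \<longleftrightarrow>
      coupled_chains.good1 p1 n1 ff ff' \<and> coupled_chains.good2 p2 n2 hh hh'"
    using coupled_chains.good1_def[OF cc[of 1]] coupled_chains.good2_def[OF cc[of 1]]
    by (simp add: n1_def n2_def)
  show ?thesis
    unfolding CCC good
  proof (intro iffI allI impI)
    assume corr: "\<forall>k<p1 * p2. \<forall>l<p1 * p2. \<forall>\<tau>. \<bar>\<tau>\<bar> < int L \<longrightarrow>
        (\<Sum>d\<in>?X. aperiodic_corr (s k d) (s l d) \<tau>) =
        (if \<tau> = 0 \<and> k = l then of_nat (p1 * p2 * L) else 0)"
    show "coupled_chains.good1 p1 n1 ff ff' \<and> coupled_chains.good2 p2 n2 hh hh'"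
    proof (rule coupled_chains.good_if_orthogonal[OF cc[of 1]])
      show "complex_of_nat (p1 * p2 * L) \<noteq> 0" using p L by simp
      fix t1 t2 t1' t2' assume t: "t1 < p1" "t1' < p1" "t2 < p2" "t2' < p2"
      define k l where "k = p1 * t2 + t1" and "l = p1 * t2' + t1'"
      have kl: "k mod p1 = t1" "k div p1 = t2" "l mod p1 = t1'" "l div p1 = t2'"
        using t by (simp_all add: k_def l_def)
      \<comment> \<open>With \<open>t1 < p1\<close> this bounds \<open>k\<close> by
        \<open>p1 * Suc t2\<close>, hence by \<open>p1 * p2\<close>; likewise for
        \<open>l\<close>.\<close>
      have "p1 * Suc t2 \<le> p1 * p2" "p1 * Suc t2' \<le> p1 * p2"
        using t by (intro mult_left_mono; simp)+
      hence lt: "k < p1 * p2" "l < p1 * p2" using t by (simp_all add: k_def l_def)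
      \<comment> \<open>Summing the correlation conditions over all shifts gives orthogonality at
        the point 1.\<close>
      have "(\<Sum>d\<in>?X. gen_poly (s k d) 1 * cnj (gen_poly (s l d) 1)) =
          (if k = l then of_nat (p1 * p2 * L) else 0)"
        using corr lt len L(1) by (intro corr_imp_gen_poly_orthogonal) auto
      thus "(\<Sum>(d1, d2)\<in>?X. ?S 1 (character p1 p2 t1 t2) d1 d2 *
          cnj (?S 1 (character p1 p2 t1' t2') d1 d2)) =
          (if t1 = t1' \<and> t2 = t2' then of_nat (p1 * p2 * L) else 0)"
        by (simp add: gp kl eq_iff[of k l] case_prod_unfold)
    qed simp
  next
    assume good: "coupled_chains.good1 p1 n1 ff ff' \<and> coupled_chains.good2 p2 n2 hh hh'"
    fix k l and \<tau> :: int assume kl: "k < p1 * p2" "l < p1 * p2" and \<tau>: "\<bar>\<tau>\<bar> < int L"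
    have "(\<Sum>d\<in>?X. gen_poly (s k d) z * cnj (gen_poly (s l d) z)) =
        (if k = l then of_nat (p1 * p2 * L) else 0)" if z: "norm z = 1" for z
    proof -
      \<comment> \<open>The operator contributes the factor
        \<open>p1 * p2 * (p1 ^ n1 * p2 ^ n2)\<close>, which is \<open>L\<close>, and the squared
        norm of a character contributes \<open>p1 * p2\<close>.\<close>
      have "(\<Sum>d\<in>?X. gen_poly (s k d) z * cnj (gen_poly (s l d) z)) =
          of_nat (p1 * p2 * (p1 ^ n1 * p2 ^ n2)) * (\<Sum>a<p1. \<Sum>b<p2. ?\<chi> k a b * cnj (?\<chi> l a b))"
        using coupled_chains.coupled_dft_isometry[OF cc[OF z], of n1 ff ff' n2 hh hh' "?\<chi> k" "?\<chi> l"] good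
        by (simp add: gp[OF z] case_prod_unfold)
      also have "\<dots> = (if k = l then of_nat (p1 * p2 * L) else 0)"
        using index_bounds kl by (subst character_orthogonal) (auto simp: eq_iff[of k l] L(2))
      finally show ?thesis .
    qed
    moreover have "length (s k d) = L \<and> length (s l d) = L" for d by (simp add: len)
    ultimately show "(\<Sum>d\<in>?X. aperiodic_corr (s k d) (s l d) \<tau>) =
        (if \<tau> = 0 \<and> k = l then of_nat (p1 * p2 * L) else 0)"
      using gen_poly_orthogonal_imp_corr[where X = ?X and a = "s k" and b = "s l", OF _ _ \<tau>] by simp
  qed
qed

end
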